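(* Let $\mathrm{b}$ be a sub-binary degree sequence, let $\mathrm{d}$ be a degree sequence with $n_0(\mathrm{d})=n_0(\mathrm{b})$ and $n_1(\mathrm{d})=n_1(\mathrm{b})$, and let $\mathrm{T}_{\mathrm{d}}$ and $\mathrm{T}_{\mathrm{b}}$ be uniformly random elements of $\mathcal{T}_{\mathrm{d}}$ and $\mathcal{T}_{\mathrm{b}}$, respectively. Then $\mathrm{ht}(\mathrm{T}_{\mathrm{d}})\preceq_{\mathrm{st}}\mathrm{ht}(\mathrm{T}_{\mathrm{b}})$.
   Context: A degree sequence is a finite sequence of non-negative integers $\mathrm{d}=(d_1,\dots,d_n)$ with $\sum_{i=1}^n d_i=n-1$ (the sequences $\mathrm{b}$ and $\mathrm{d}$ need not have the same length). $n_i(\mathrm{d})=|\{j:d_j=i\}|$. A degree sequence $\mathrm{d}$ is sub-binary if $n_i(\mathrm{d})=0$ for all $i\ge 3$. $\mathcal{T}_{\mathrm{d}}$ is the set of rooted labeled trees with vertex set $[n]=\{1,\dots,n\}$ in which, for each $i$, vertex $i$ has exactly $d_i$ children. The height $\mathrm{ht}$ of a rooted tree is the maximum graph distance from the root to a vertex. For random variables $X,Y$, $X\preceq_{\mathrm{st}}Y$ means $\mathbf{P}(X\le t)\ge\mathbf{P}(Y\le t)$ for all $t\in\mathbb{R}$. *)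

theory Defs
  imports "HOL-Probability.Probability" "Graph_Theory.Graph_Theory"
begin

text \<open>
  The entries are indexed from 0 in the list and from 1 in the mathematics: \<open>d\<^sub>i\<close> is \<open>d ! (i - 1)\<close>.
  Adding 1 on the left avoids truncated subtraction, under which the empty list would qualify.
\<close>

definition degree_sequence :: "nat list \<Rightarrow> bool" where
  "degree_sequence d \<longleftrightarrow> sum_list d + 1 = length d"

definition sub_binary :: "nat list \<Rightarrow> bool" where
  "sub_binary d \<longleftrightarrow> (\<forall>i\<ge>3. count_list d i = 0)"

text \<open>
  A \<open>pair_graph\<close> is a finite simple graph, each edge being represented by its two opposite arcs.
  Such a pair of arcs counts as a \<open>cycle\<close> of length 2, so the graph-theoretic cycles are those of
  length at least 3. (For the same reason \<open>Digraph_Component.tree\<close>, which forbids every directed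
  cycle, is not the notion of a tree for these graphs.)
\<close>

definition is_tree :: "'a pair_pre_digraph \<Rightarrow> bool" where
  "is_tree G \<longleftrightarrow> pair_graph G \<and> Digraph_Component.connected (with_proj G) \<and>
     \<not> (\<exists>p. pre_digraph.cycle (with_proj G) p \<and> length p \<ge> 3)"

definition graph_dist :: "'a pair_pre_digraph \<Rightarrow> 'a \<Rightarrow> 'a \<Rightarrow> nat" where
  "graph_dist G u v = (LEAST k. \<exists>p. pre_digraph.awalk (with_proj G) u p v \<and> length p = k)"

type_synonym 'a rooted_graph = "'a pair_pre_digraph \<times> 'a"

definition rooted_tree :: "'a rooted_graph \<Rightarrow> bool" where
  "rooted_tree T \<longleftrightarrow> is_tree (fst T) \<and> snd T \<in> pverts (fst T)"

definition children :: "'a rooted_graph \<Rightarrow> 'a \<Rightarrow> 'a set" where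
  "children T v = {w. (v, w) \<in> parcs (fst T) \<and>
     graph_dist (fst T) (snd T) w = graph_dist (fst T) (snd T) v + 1}"

definition tree_height :: "'a rooted_graph \<Rightarrow> nat" where
  "tree_height T = Max (graph_dist (fst T) (snd T) ` pverts (fst T))"

definition trees_with_degrees :: "nat list \<Rightarrow> nat rooted_graph set" where
  "trees_with_degrees d = {T. rooted_tree T \<and> pverts (fst T) = {1..length d} \<and>
     (\<forall>i\<in>{1..length d}. card (children T i) = d ! (i - 1))}"

definition uniform_random_element :: "'w measure \<Rightarrow> ('w \<Rightarrow> 'a) \<Rightarrow> 'a set \<Rightarrow> bool" where
  "uniform_random_element P X A \<longleftrightarrow> prob_space P \<and> X \<in> P \<rightarrow>\<^sub>M count_space A \<and>
     distr P (count_space A) X = uniform_count_measure A"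

text \<open>The two random variables need not live on the same probability space.\<close>

definition stochastically_le ::
  "'w measure \<Rightarrow> ('w \<Rightarrow> real) \<Rightarrow> 'v measure \<Rightarrow> ('v \<Rightarrow> real) \<Rightarrow> bool" where
  "stochastically_le P X Q Y \<longleftrightarrow>
     (\<forall>t. measure P {\<omega> \<in> space P. X \<omega> \<le> t} \<ge> measure Q {\<omega> \<in> space Q. Y \<omega> \<le> t})"

end

theory Submission
  imports Defs
begin

text \<open>
  Suppose \<open>d\<close> has an entry \<open>k \<ge> 3\<close>. Inserting a unary vertex only raises the height, so it is enough to
  compare the child counts \<open>(k, 1)\<close> and \<open>(k - 1, 2)\<close> at two vertices \<open>a\<close>, \<open>c\<close>; iterating turns \<open>d\<close> into
  a permutation of \<open>b\<close>. Pool the \<open>K = k + 1\<close> children of \<open>a\<close> and \<open>c\<close> and fix everything else; the tree is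
  then determined by the set \<open>X\<close> of children handed to \<open>c\<close>. If \<open>c\<close> is the deeper of the two, the
  tree is acyclic with height below \<open>s\<close> iff \<open>X\<close> avoids a fixed set of \<open>r\<close> obstructing children (possibly
  no \<open>X\<close> works at all). Symmetrising in \<open>a\<close> and \<open>c\<close>, the number of good \<open>X\<close> for the split \<open>(K - l, l)\<close>
  is \<open>(K - r choose l) + (K - r choose (K - l))\<close>, whose ratio to \<open>K choose l\<close> does not
  increase from \<open>l = 1\<close> to \<open>l = 2\<close>, with equality for \<open>r \<le> 1\<close>. Without a bound on the height,
  \<open>r \<le> 1\<close> always holds, so the total numbers of trees are in exactly that ratio.
\<close>

section \<open>Redirecting children\<close>

text \<open>Acyclicity and a height bound in a single condition: the functional graph of
  \<open>p\<close> is a tree directed towards the sink \<open>0\<close>, with every number at most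
  \<open>s\<close> steps away.\<close>

definition vanishes_by :: "(nat \<Rightarrow> nat) \<Rightarrow> nat \<Rightarrow> bool" where
  "vanishes_by p s \<longleftrightarrow> (\<forall>v. (p ^^ s) v = 0)"

definition depth :: "(nat \<Rightarrow> nat) \<Rightarrow> nat \<Rightarrow> nat" where
  "depth p v = (LEAST i. (p ^^ i) v = 0)"

lemma vanishes_by_fixes_0:
  assumes "vanishes_by p s"
  shows "p 0 = 0"
proof -
  have "p 0 = p ((p ^^ s) 0)" using assms by (simp add: vanishes_by_def)
  also have "\<dots> = (p ^^ s) (p 0)" by (simp add: funpow_swap1)
  finally show ?thesis using assms by (simp add: vanishes_by_def)
qed

lemma funpow_fixes_0: "p 0 = 0 \<Longrightarrow> (p ^^ i) 0 = 0" for p :: "nat \<Rightarrow> nat"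
  by (induction i) auto

lemma vanishes_by_mono:
  assumes "vanishes_by p s" "s \<le> t"
  shows "vanishes_by p t"
proof -
  have "(p ^^ t) v = (p ^^ s) ((p ^^ (t - s)) v)" for v
    using assms(2) by (metis comp_apply funpow_add le_add_diff_inverse)
  then show ?thesis using assms(1) by (simp add: vanishes_by_def)
qed

lemma depth_le: "vanishes_by p s \<Longrightarrow> depth p v \<le> s"
  unfolding depth_def vanishes_by_def by (rule Least_le) blast

lemma depth_le_iff:
  assumes "vanishes_by p s"
  shows "depth p v \<le> i \<longleftrightarrow> (p ^^ i) v = 0"
proof
  assume "(p ^^ i) v = 0"
  then show "depth p v \<le> i" unfolding depth_def by (rule Least_le)
next
  assume le: "depth p v \<le> i"
  have "(p ^^ depth p v) v = 0"
    unfolding depth_def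
    by (rule LeastI[of "\<lambda>i. (p ^^ i) v = 0" s]) (use assms in \<open>simp add: vanishes_by_def\<close>)
  moreover have "(p ^^ i) v = (p ^^ (i - depth p v)) ((p ^^ depth p v) v)"
    using le by (metis comp_apply funpow_add le_add_diff_inverse2)
  ultimately show "(p ^^ i) v = 0"
    using funpow_fixes_0 vanishes_by_fixes_0[OF assms] by simp
qed

lemma depth_0 [simp]: "depth p 0 = 0"
  unfolding depth_def by (rule Least_eq_0) simp

lemma depth_Suc:
  assumes "vanishes_by p s" "v \<noteq> 0"
  shows "depth p v = Suc (depth p (p v))"
proof -
  have "depth p v \<le> Suc i \<longleftrightarrow> depth p (p v) \<le> i" for i
    unfolding depth_le_iff[OF assms(1)] by (simp add: funpow_swap1)
  moreover have "depth p v \<noteq> 0"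
    using depth_le_iff[OF assms(1), of v 0] assms(2) by simp
  ultimately show ?thesis by (metis Suc_le_D Suc_le_mono le_antisym order_refl not0_implies_Suc)
qed

lemma depth_funpow:
  assumes "vanishes_by p s" "(p ^^ i) v \<noteq> 0"
  shows "depth p v = i + depth p ((p ^^ i) v)"
  using assms(2)
proof (induction i)
  case (Suc i)
  have "(p ^^ i) v \<noteq> 0"
    by (rule notI) (use Suc.prems vanishes_by_fixes_0[OF assms(1)] in simp)
  then show ?case using Suc.IH depth_Suc[OF assms(1), of "(p ^^ i) v"] by simp
qed simp

text \<open>A nonzero periodic point would have a depth exceeding itself by
  \<open>Suc j\<close>.\<close>

lemma vanishes_by_no_cycle:
  assumes "vanishes_by p s" "(p ^^ Suc j) v = v"
  shows "v = 0"
proof (rule ccontr)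
  assume "v \<noteq> 0"
  then show False using depth_funpow[OF assms(1), of "Suc j" v] unfolding assms(2) by simp
qed

text \<open>Serves to bound the height of a modified map by a rank computed from the unmodified one:
  the rank drops at every step, so \<open>s\<close> steps suffice.\<close>

lemma vanishes_by_rank:
  fixes rk :: "nat \<Rightarrow> nat"
  assumes "p 0 = 0" and "\<And>v. v \<noteq> 0 \<Longrightarrow> rk (p v) < rk v" and "\<And>v. rk v \<le> s"
  shows "vanishes_by p s"
proof -
  have "(p ^^ i) v = 0 \<or> rk ((p ^^ i) v) + i \<le> rk v" for i v
  proof (induction i)
    case (Suc i)
    show ?case
    proof (cases "(p ^^ i) v = 0")
      case False
      then show ?thesis using Suc assms(2)[OF False] by auto
    qed (use assms(1) in simp)
  qed simp
  \<comment> \<open>After \<open>s\<close> steps either the sink has been reached or the rank is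
    used up, and no other number has rank \<open>0\<close>.\<close>
  then have "(p ^^ s) v = 0 \<or> rk ((p ^^ s) v) = 0" for v
    using assms(3)[of v] by (meson add_le_same_cancel2 le_trans le_zero_eq)
  moreover have "rk v \<noteq> 0" if "v \<noteq> 0" for v
    using assms(2)[OF that] by simp
  ultimately show ?thesis by (metis vanishes_by_def)
qed

lemma funpow_eq_of_eq_along:
  assumes "\<And>i. i < j \<Longrightarrow> g ((f ^^ i) v) = f ((f ^^ i) v)"
  shows "(g ^^ j) v = (f ^^ j) v"
  using assms by (induction j) auto

section \<open>Moving a set of children to another vertex\<close>

definition redirect :: "('a \<Rightarrow> 'b) \<Rightarrow> 'a set \<Rightarrow> 'b \<Rightarrow> 'a \<Rightarrow> 'b" where
  "redirect q X c v = (if v \<in> X then c else q v)"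

lemma redirect_empty [simp]: "redirect q {} c = q"
  by (simp add: redirect_def fun_eq_iff)

lemma funpow_redirect:
  assumes "\<And>i. i < j \<Longrightarrow> (q ^^ i) v \<notin> X"
  shows "(redirect q X c ^^ j) v = (q ^^ j) v"
  by (rule funpow_eq_of_eq_along) (use assms in \<open>simp add: redirect_def\<close>)

text \<open>
  A child \<open>\<sigma>\<close> of \<open>a\<close> cannot move to \<open>c\<close> if it lies above \<open>c\<close>, since that would close a cycle, or if some
  vertex below it would then get a depth exceeding \<open>s\<close>.
\<close>

definition obstructing :: "(nat \<Rightarrow> nat) \<Rightarrow> nat \<Rightarrow> nat \<Rightarrow> nat \<Rightarrow> nat set" where
  "obstructing q a c s = {\<sigma> \<in> q -` {a}. (\<exists>i. (q ^^ i) c = \<sigma>) \<or>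
     (\<exists>v i. (q ^^ i) v = \<sigma> \<and> depth q v + (depth q c - depth q a) > s)}"

context
  fixes q :: "nat \<Rightarrow> nat" and a c s0 :: nat
  assumes van: "vanishes_by q s0" and a0: "a \<noteq> 0" and c0: "c \<noteq> 0"
    and le: "depth q a \<le> depth q c"
begin

lemma not_revisit: "q ((q ^^ i) a) \<noteq> a"
  using vanishes_by_no_cycle[OF van, of i a] a0 by auto

text \<open>After passing through \<open>a\<close> an orbit never returns there, so every vertex
  lies below at most one child of \<open>a\<close>.\<close>

lemma orbit_hits_once:
  assumes "q ((q ^^ i) v) = a" "q ((q ^^ j) v) = a"
  shows "i = j"
proof -
  have aux: False if "i < j" "q ((q ^^ i) v) = a" "q ((q ^^ j) v) = a" for i j
  proof -
    have "(q ^^ j) v = (q ^^ (j - Suc i)) ((q ^^ Suc i) v)"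
      using that(1) by (metis Suc_leI comp_apply funpow_add le_add_diff_inverse2)
    then show False using that not_revisit by simp
  qed
  then show ?thesis using assms by (meson nat_neq_iff)
qed


text \<open>Moving \<open>X\<close> from \<open>a\<close> to \<open>c\<close> pushes everything at
  or below \<open>X\<close> down by the difference of the two depths, which is not truncated because
  \<open>c\<close> is at least as deep, and leaves the other vertices in place. The new depths serve
  as the rank.\<close>

lemma redirect_vanishes_if:
  assumes X: "X \<subseteq> q -` {a}" and disj: "X \<inter> obstructing q a c s = {}" and s: "vanishes_by q s"
  shows "vanishes_by (redirect q X c) s"
proof -
  define e where "e = depth q c - depth q a"
  define rk where "rk v = depth q v + (if \<exists>i. (q ^^ i) v \<in> X then e else 0)" for v
  note q0 = vanishes_by_fixes_0[OF van]
  have zX: "0 \<notin> X" using X q0 a0 by auto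
  have c_free: "(q ^^ i) c \<notin> X" for i
    using disj X by (auto simp: obstructing_def)
  have a_free: "(q ^^ i) a \<notin> X" for i
    using X not_revisit by auto
  show ?thesis
  proof (rule vanishes_by_rank[where rk = rk])
    show "redirect q X c 0 = 0" using zX q0 by (simp add: redirect_def)
  next
    fix v :: nat assume v: "v \<noteq> 0"
    note dv = depth_Suc[OF van v]
    show "rk (redirect q X c v) < rk v"
    proof (cases "v \<in> X")
      case True
      then have "q v = a" using X by auto
      moreover have "\<exists>i. (q ^^ i) v \<in> X" using True by (metis funpow_0)
      ultimately have "rk v = depth q c + 1"
        using dv le by (simp add: rk_def e_def)
      moreover have "rk c = depth q c" using c_free by (simp add: rk_def)
      ultimately show ?thesis using True by (simp add: redirect_def)
    next
      case False
      \<comment> \<open>If \<open>q v\<close> lies at or below \<open>X\<close>, then so does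
        \<open>v\<close>; hence the extra \<open>e\<close> is never picked up on the way, and the
        drop comes from the depth.\<close>
      have "\<exists>i. (q ^^ i) v \<in> X" if "(q ^^ i) (q v) \<in> X" for i
        using that by (metis comp_apply funpow_Suc_right)
      then show ?thesis using False dv by (auto simp: redirect_def rk_def)
    qed
  next
    fix v
    show "rk v \<le> s"
    proof (cases "\<exists>i. (q ^^ i) v \<in> X")
      case True
      then obtain i where i: "(q ^^ i) v \<in> X" by blast
      then have "(q ^^ i) v \<notin> obstructing q a c s" using disj by auto
      then have "depth q v + e \<le> s"
        using i X unfolding obstructing_def e_def by fastforce
      then show ?thesis by (simp add: rk_def)
    qed (use depth_le[OF s] in \<open>simp add: rk_def\<close>)
  qed
qed

text \<open>Under the redirected map the orbit of a vertex at or below \<open>X\<close> follows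
  \<open>q\<close> to its one element of \<open>X\<close> and continues at \<open>c\<close>. An
  obstructing element would thus produce a cycle through \<open>c\<close> or a depth above
  \<open>s\<close>.\<close>

lemma redirect_vanishes_only_if:
  assumes X: "X \<subseteq> q -` {a}" and p: "vanishes_by (redirect q X c) s"
  shows "X \<inter> obstructing q a c s = {}"
proof -
  define p where "p = redirect q X c"
  have van_p: "vanishes_by p s" using assms(2) by (simp add: p_def)
  have first: "(p ^^ Suc i) v = c" if "(q ^^ i) v \<in> X" for i v
  proof -
    have "(q ^^ j) v \<notin> X" if "j < i" for j
      using orbit_hits_once[of i v j] X \<open>(q ^^ i) v \<in> X\<close> that by auto
    then have "(p ^^ i) v = (q ^^ i) v" unfolding p_def by (rule funpow_redirect)
    then show ?thesis using that by (simp add: p_def redirect_def)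
  qed
  have c_free: "(q ^^ i) c \<notin> X" for i
    using vanishes_by_no_cycle[OF van_p, of i c] first[of i c] c0 by blast
  have pc: "depth p c = depth q c"
  proof -
    have "(p ^^ j) c = (q ^^ j) c" for j
      unfolding p_def by (rule funpow_redirect) (use c_free in blast)
    then show ?thesis by (simp add: depth_def)
  qed
  \<comment> \<open>\<open>Suc i\<close> steps lead from \<open>v\<close> to \<open>c\<close> under
    \<open>p\<close> and to \<open>a\<close> under \<open>q\<close>, so the depth grows by exactly
    the difference of the depths of \<open>c\<close> and \<open>a\<close>.\<close>
  have "depth q v + (depth q c - depth q a) \<le> s" if "(q ^^ i) v \<in> X" for v i
  proof -
    have "(p ^^ Suc i) v = c" by (rule first[OF that])
    then have "depth p v = Suc i + depth q c"
      using depth_funpow[OF van_p, of "Suc i" v] c0 pc by simp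
    moreover have "depth q v = Suc i + depth q a"
    proof -
      have "(q ^^ Suc i) v = a" using that X by auto
      then show ?thesis using depth_funpow[OF van, of "Suc i" v] a0 by simp
    qed
    ultimately show ?thesis using depth_le[OF van_p, of v] le by simp
  qed
  then show ?thesis using c_free unfolding obstructing_def by (auto simp: not_le[symmetric])
qed

text \<open>The hypothesis makes the height bound void. Only the danger of a cycle remains, and the
  orbit of \<open>c\<close> meets at most one child of \<open>a\<close>.\<close>

lemma card_obstructing_le_1:
  assumes "\<And>X t. X \<subseteq> q -` {a} \<Longrightarrow> vanishes_by (redirect q X c) t \<Longrightarrow> vanishes_by (redirect q X c) s"
  shows "card (obstructing q a c s) \<le> 1"
proof -
  have s: "vanishes_by q s" using assms[of "{}" s0] van by simp
  have "\<exists>i. (q ^^ i) c = \<sigma>" if \<sigma>: "\<sigma> \<in> obstructing q a c s" for \<sigma>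
  proof (rule ccontr)
    assume no: "\<not> ?thesis"
    have sub: "{\<sigma>} \<subseteq> q -` {a}" using \<sigma> by (auto simp: obstructing_def)
    \<comment> \<open>A redirection adds at most the depth of \<open>c\<close>, so the new depths
      stay within \<open>2 * s\<close>. At that bound \<open>\<sigma>\<close> does not obstruct, and
      the hypothesis brings the bound back to \<open>s\<close>.\<close>
    have "depth q v + (depth q c - depth q a) \<le> 2 * s" for v
      using depth_le[OF s, of v] depth_le[OF s, of c] by linarith
    then have "{\<sigma>} \<inter> obstructing q a c (2 * s) = {}"
      using no by (auto simp: obstructing_def not_le[symmetric])
    then have "vanishes_by (redirect q {\<sigma>} c) (2 * s)"
      using redirect_vanishes_if[OF sub] vanishes_by_mono[OF s, of "2 * s"] by simp
    then have "{\<sigma>} \<inter> obstructing q a c s = {}"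
      using assms[OF sub] redirect_vanishes_only_if[OF sub] by blast
    then show False using \<sigma> by simp
  qed
  then have "\<sigma> = \<tau>" if "\<sigma> \<in> obstructing q a c s" "\<tau> \<in> obstructing q a c s" for \<sigma> \<tau>
    using that orbit_hits_once[of _ c] unfolding obstructing_def
    by (metis (mono_tags, lifting) mem_Collect_eq singletonD vimageE)
  then show ?thesis
    by (metis card.empty is_singletonI' is_singleton_altdef le_refl zero_le_one)
qed

end

text \<open>Giving \<open>X\<close> back to \<open>a\<close>, which is not deeper than
  \<open>c\<close>, moves no vertex away from the sink, so the depths under the redirected map still
  work as a rank. Neither \<open>a\<close> nor \<open>c\<close> lies below \<open>X\<close>, so
  their own depths do not change.\<close>

lemma redirect_base_case:
  assumes "a \<noteq> 0" "c \<noteq> 0" and X: "X \<subseteq> q -` {a}"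
    and van: "vanishes_by (redirect q X c) s"
    and le: "depth (redirect q X c) a \<le> depth (redirect q X c) c"
  shows "vanishes_by q s \<and> depth q a \<le> depth q c"
proof -
  define p where "p = redirect q X c"
  have van_p: "vanishes_by p s" using van by (simp add: p_def)
  have le': "depth p a \<le> depth p c" using le by (simp add: p_def)
  have q: "q = redirect p X a"
    using X by (auto simp: fun_eq_iff p_def redirect_def)
  have pX: "p v = c" if "v \<in> X" for v using that by (simp add: p_def redirect_def)
  \<comment> \<open>Elements of \<open>X\<close> have parent \<open>c\<close> under
    \<open>p\<close>, so an \<open>a\<close> below one of them would be deeper than
    \<open>c\<close>.\<close>
  have a_free: "(p ^^ i) a \<notin> X" for i
  proof
    assume "(p ^^ i) a \<in> X"
    then have "(p ^^ Suc i) a = c" by (simp add: pX)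
    then have "depth p a = Suc i + depth p c"
      using depth_funpow[OF van_p, of "Suc i" a] assms(2) by simp
    then show False using le by (simp add: p_def)
  qed
  have c_free: "(p ^^ i) c \<notin> X" for i
  proof
    assume "(p ^^ i) c \<in> X"
    then have "(p ^^ Suc i) c = c" by (simp add: pX)
    then show False using vanishes_by_no_cycle[OF van_p] assms(2) by blast
  qed
  have "(q ^^ j) a = (p ^^ j) a" "(q ^^ j) c = (p ^^ j) c" for j
    unfolding q by (rule funpow_redirect; use a_free c_free in blast)+
  then have "depth q a = depth p a" "depth q c = depth p c"
    by (simp_all add: depth_def)
  moreover have "vanishes_by q s"
  proof (rule vanishes_by_rank[where rk = "depth p"])
    have "0 \<notin> X" using pX vanishes_by_fixes_0[OF van_p] assms(2) by force
    then show "q 0 = 0" using vanishes_by_fixes_0[OF van_p] by (simp add: q redirect_def)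
  next
    fix v :: nat assume "v \<noteq> 0"
    then show "depth p (q v) < depth p v"
      using depth_Suc[OF van_p, of v] pX[of v] le'
      by (cases "v \<in> X") (auto simp: q redirect_def)
  qed (rule depth_le[OF van_p])
  ultimately show ?thesis using le by (simp add: p_def)
qed

text \<open>A single successful \<open>X\<close> shows which of the two vertices can be treated as
  the deeper one. If it is \<open>c\<close>, success means that \<open>Y\<close> avoids the
  obstruction; if it is \<open>a\<close>, the complement of \<open>Y\<close> has to avoid it, which
  gives the second form.\<close>

lemma redirect_vanishing_structure:
  assumes "a \<noteq> 0" "c \<noteq> 0" and c: "c \<notin> range q" and X: "X \<subseteq> q -` {a}"
    and van: "vanishes_by (redirect q X c) s"
  obtains B where "B \<subseteq> q -` {a}"
    and "(\<forall>Y\<subseteq>q -` {a}. vanishes_by (redirect q Y c) s \<longleftrightarrow> Y \<inter> B = {}) \<or>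
         (\<forall>Y\<subseteq>q -` {a}. vanishes_by (redirect q Y c) s \<longleftrightarrow> B \<subseteq> Y)"
    and "(\<And>Y t. Y \<subseteq> q -` {a} \<Longrightarrow> vanishes_by (redirect q Y c) t \<Longrightarrow> vanishes_by (redirect q Y c) s)
         \<Longrightarrow> card B \<le> 1"
proof (cases "depth (redirect q X c) a \<le> depth (redirect q X c) c")
  case True
  then have q: "vanishes_by q s" "depth q a \<le> depth q c"
    using redirect_base_case[OF assms(1,2) X van] by auto
  show ?thesis
  proof (rule that[of "obstructing q a c s"])
    show "obstructing q a c s \<subseteq> q -` {a}" by (auto simp: obstructing_def)
    have "vanishes_by (redirect q Y c) s \<longleftrightarrow> Y \<inter> obstructing q a c s = {}" if "Y \<subseteq> q -` {a}" for Y
      using redirect_vanishes_if[OF q(1) assms(1,2) q(2) that _ q(1)]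
        redirect_vanishes_only_if[OF q(1) assms(1,2) q(2) that] by blast
    then show "(\<forall>Y\<subseteq>q -` {a}. vanishes_by (redirect q Y c) s \<longleftrightarrow> Y \<inter> obstructing q a c s = {}) \<or>
         (\<forall>Y\<subseteq>q -` {a}. vanishes_by (redirect q Y c) s \<longleftrightarrow> obstructing q a c s \<subseteq> Y)"
      by simp
    show "card (obstructing q a c s) \<le> 1"
      if "\<And>Y t. Y \<subseteq> q -` {a} \<Longrightarrow> vanishes_by (redirect q Y c) t \<Longrightarrow> vanishes_by (redirect q Y c) s"
      using card_obstructing_le_1[OF q(1) assms(1,2) q(2)] that by blast
  qed
next
  case False
  \<comment> \<open>Exchange of roles: under \<open>q'\<close> all pooled children belong to
    \<open>c\<close>, and those outside \<open>Y\<close> move to \<open>a\<close>. As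
    \<open>c\<close> has no child under \<open>q\<close>, its children under \<open>q'\<close> are
    exactly \<open>S\<close>.\<close>
  define S where "S = q -` {a}"
  define q' where "q' = redirect q S c"
  have S: "q' -` {c} = S" using c by (auto simp: q'_def redirect_def S_def)
  have swap: "redirect q' (S - Y) a = redirect q Y c" if "Y \<subseteq> S" for Y
    using that by (auto simp: fun_eq_iff q'_def redirect_def S_def)
  have swap': "redirect q' Y a = redirect q (S - Y) c" if "Y \<subseteq> S" for Y
    using swap[of "S - Y"] that by (simp add: double_diff)
  have XS: "X \<subseteq> S" using X by (simp add: S_def)
  have q: "vanishes_by q' s" "depth q' c \<le> depth q' a"
    using redirect_base_case[OF assms(2,1), of "S - X" q' s] van False unfolding S
    by (auto simp: swap[OF XS])
  have iff: "vanishes_by (redirect q Y c) s \<longleftrightarrow> obstructing q' c a s \<subseteq> Y" if "Y \<subseteq> S" for Y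
  proof -
    have sub: "S - Y \<subseteq> q' -` {c}" unfolding S by blast
    have "vanishes_by (redirect q' (S - Y) a) s \<longleftrightarrow> (S - Y) \<inter> obstructing q' c a s = {}"
      using redirect_vanishes_if[OF q(1) assms(2,1) q(2) sub _ q(1)]
        redirect_vanishes_only_if[OF q(1) assms(2,1) q(2) sub] by blast
    moreover have "obstructing q' c a s \<subseteq> S" unfolding S[symmetric] by (auto simp: obstructing_def)
    ultimately show ?thesis unfolding swap[OF that] by blast
  qed
  show ?thesis
  proof (rule that[of "obstructing q' c a s"])
    show "obstructing q' c a s \<subseteq> q -` {a}"
      unfolding S_def[symmetric] S[symmetric] by (auto simp: obstructing_def)
    show "(\<forall>Y\<subseteq>q -` {a}. vanishes_by (redirect q Y c) s \<longleftrightarrow> Y \<inter> obstructing q' c a s = {}) \<or>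
         (\<forall>Y\<subseteq>q -` {a}. vanishes_by (redirect q Y c) s \<longleftrightarrow> obstructing q' c a s \<subseteq> Y)"
      using iff unfolding S_def by blast
    show "card (obstructing q' c a s) \<le> 1"
      if large: "\<And>Y t. Y \<subseteq> q -` {a} \<Longrightarrow> vanishes_by (redirect q Y c) t \<Longrightarrow> vanishes_by (redirect q Y c) s"
    proof (rule card_obstructing_le_1[OF q(1) assms(2,1) q(2)])
      fix Y t assume Y: "Y \<subseteq> q' -` {c}" "vanishes_by (redirect q' Y a) t"
      then have "Y \<subseteq> S" by (simp add: S)
      then show "vanishes_by (redirect q' Y a) s"
        using Y(2) large[of "S - Y" t] by (simp add: swap' S_def)
    qed
  qed
qed

section \<open>Counting subsets with a prescribed obstruction\<close>

lemma card_subsets_avoiding: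
  assumes "finite S" "B \<subseteq> S"
  shows "card {X. X \<subseteq> S \<and> card X = l \<and> X \<inter> B = {}} = (card S - card B) choose l"
proof -
  have "{X. X \<subseteq> S \<and> card X = l \<and> X \<inter> B = {}} = {X. X \<subseteq> S - B \<and> card X = l}" by blast
  then show ?thesis
    using n_subsets[of "S - B" l] assms by (simp add: card_Diff_subset finite_subset)
qed

lemma card_subsets_containing:
  assumes "finite S" "B \<subseteq> S" "l \<le> card S"
  shows "card {X. X \<subseteq> S \<and> card X = l \<and> B \<subseteq> X} = (card S - card B) choose (card S - l)"
proof -
  have "bij_betw (\<lambda>X. S - X) {X. X \<subseteq> S \<and> card X = l \<and> B \<subseteq> X}
     {X. X \<subseteq> S \<and> card X = card S - l \<and> X \<inter> B = {}}"
    by (rule bij_betw_byWitness[where f' = "\<lambda>X. S - X"])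
      (use assms in \<open>auto simp: card_Diff_subset finite_subset double_diff\<close>)
  from bij_betw_same_card[OF this] show ?thesis
    by (simp add: card_subsets_avoiding assms)
qed

text \<open>With \<open>r\<close> obstructing children out of \<open>K\<close>, both sides contain
  symmetrised counts of good choices. The factors clear the denominators \<open>K choose 2\<close>
  and \<open>K choose 1\<close>, whose quotient is \<open>(K - 1) / 2\<close>.\<close>

lemma choose_balance:
  assumes "K \<ge> 4" "r \<le> K"
  shows "2 * (((K - r) choose 2) + ((K - r) choose (K - 2)))
       \<le> (K - 1) * (((K - r) choose 1) + ((K - r) choose (K - 1)))" (is "?L \<le> ?R")
    and "r \<le> 1 \<Longrightarrow> 2 * (((K - r) choose 2) + ((K - r) choose (K - 2)))
       = (K - 1) * (((K - r) choose 1) + ((K - r) choose (K - 1)))"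
proof -
  have two: "2 * (m choose 2) = m * (m - 1)" for m :: nat
  proof -
    have "even (m * (m - 1))" by (cases m) auto
    then show ?thesis by (simp only: choose_two dvd_mult_div_cancel)
  qed
  have eq: "?L = ?R" if "r \<le> 1"
  proof (cases "r = 0")
    case True
    have "K choose (K - 2) = K choose 2" "K choose (K - 1) = K"
      using assms(1) binomial_symmetric[of 2 K] binomial_symmetric[of 1 K] by simp_all
    then show ?thesis using True two[of K] by (simp add: algebra_simps)
  next
    case False
    obtain j where K: "K = j + 2" using assms(1) by (metis add.commute le_Suc_ex numeral_Bit0 add_leE)
    have j: "(j + 1) choose j = j + 1" using binomial_symmetric[of 1 "j + 1"] by simp
    have e: "K - r = j + 1" "K - 2 = j" "K - 1 = j + 1" using False that K by simp_all
    have "2 * (((j + 1) choose 2) + ((j + 1) choose j)) = (j + 1) * (((j + 1) choose 1) + ((j + 1) choose (j + 1)))"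
      unfolding distrib_left two j binomial_n_n choose_one by (simp add: algebra_simps)
    then show ?thesis unfolding e .
  qed
  then show "r \<le> 1 \<Longrightarrow> ?L = ?R" .
  show "?L \<le> ?R"
  proof (cases "r \<le> 1")
    case True
    then show ?thesis using eq by simp
  next
    case False
    then obtain j where r: "r = j + 2" by (metis add.commute le_Suc_ex not_less_eq_eq numeral_2_eq_2 One_nat_def)
    obtain i where K: "K = i + j + 2" using assms(2) r by (metis add.commute add.assoc le_Suc_ex)
    \<comment> \<open>For \<open>r = 2\<close> exactly one set of size \<open>K - 2\<close> avoids
      the obstruction, and the claim is \<open>i * (i - 1) + 2 \<le> (i + 1) * i\<close> with
      \<open>i \<ge> 2\<close>. For larger \<open>r\<close> both complementary binomials
      vanish.\<close>
    show ?thesis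
    proof (cases "j = 0")
      case True
      obtain h where "i = h + 2" using assms(1) K True by (metis add_le_cancel_right add.commute add_0 le_Suc_ex numeral_Bit0)
      then show ?thesis using two[of i] K r True by (simp add: algebra_simps)
    next
      case False
      have "2 * (i choose 2) \<le> (i + j + 1) * i" unfolding two by (subst mult.commute) (rule mult_right_mono; simp)
      moreover have "i choose (i + j) = 0" "i choose (i + j + 1) = 0"
        using False by (simp_all add: binomial_eq_0)
      moreover have "K - r = i" "K - 2 = i + j" "K - 1 = i + j + 1" using K r by simp_all
      ultimately show ?thesis by (simp only: choose_one add_0_right)
    qed
  qed
qed

lemma card_vanishing_balance:
  fixes q :: "nat \<Rightarrow> nat" and a c :: nat
  defines "N s l \<equiv> card {X. X \<subseteq> q -` {a} \<and> card X = l \<and> vanishes_by (redirect q X c) s}"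
  assumes "a \<noteq> 0" "c \<noteq> 0" "c \<notin> range q" and fin: "finite (q -` {a})"
    and K: "card (q -` {a}) = K" "K \<ge> 4"
  shows "2 * (N s 2 + N s (K - 2)) \<le> (K - 1) * (N s 1 + N s (K - 1))"
    and "(\<And>Y t. Y \<subseteq> q -` {a} \<Longrightarrow> vanishes_by (redirect q Y c) t \<Longrightarrow> vanishes_by (redirect q Y c) s)
      \<Longrightarrow> 2 * (N s 2 + N s (K - 2)) = (K - 1) * (N s 1 + N s (K - 1))"
proof -
  define large where "large \<longleftrightarrow>
    (\<forall>Y t. Y \<subseteq> q -` {a} \<longrightarrow> vanishes_by (redirect q Y c) t \<longrightarrow> vanishes_by (redirect q Y c) s)"
  have "2 * (N s 2 + N s (K - 2)) \<le> (K - 1) * (N s 1 + N s (K - 1)) \<and>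
    (large \<longrightarrow> 2 * (N s 2 + N s (K - 2)) = (K - 1) * (N s 1 + N s (K - 1)))"
  \<comment> \<open>The structure lemma starts from a successful \<open>X\<close>; if there is none,
    all counts are \<open>0\<close>.\<close>
  proof (cases "\<exists>X\<subseteq>q -` {a}. vanishes_by (redirect q X c) s")
    case False
    then have e: "{X. X \<subseteq> q -` {a} \<and> card X = l \<and> vanishes_by (redirect q X c) s} = {}" for l
      by blast
    have "N s l = 0" for l by (simp only: N_def e card.empty)
    then show ?thesis by simp
  next
    case True
    then obtain X where X: "X \<subseteq> q -` {a}" "vanishes_by (redirect q X c) s" by blast
    obtain B where B: "B \<subseteq> q -` {a}"
      "(\<forall>Y\<subseteq>q -` {a}. vanishes_by (redirect q Y c) s \<longleftrightarrow> Y \<inter> B = {}) \<or>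
         (\<forall>Y\<subseteq>q -` {a}. vanishes_by (redirect q Y c) s \<longleftrightarrow> B \<subseteq> Y)"
      and B_large: "large \<Longrightarrow> card B \<le> 1"
    proof (rule redirect_vanishing_structure[OF assms(2-4) X], goal_cases)
      case (1 B)
      show ?case
      proof (rule 1(1))
        assume large
        then show "card B \<le> 1" by (intro 1(4)) (auto simp: large_def)
      qed (rule 1(2), rule 1(3))
    qed
    define r where "r = card B"
    have r: "r \<le> K" using B(1) K(1) card_mono[OF fin] by (auto simp: r_def)
    \<comment> \<open>The two forms of \<open>B\<close> give \<open>(K - r) choose l\<close> and
      \<open>(K - r) choose (K - l)\<close> respectively. Adding the counts for \<open>l\<close> and
      \<open>K - l\<close> erases the difference.\<close>
    have N: "N s l + N s (K - l) = ((K - r) choose l) + ((K - r) choose (K - l))" if "l \<le> K" for l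
      using B(2)
    proof
      assume *: "\<forall>Y\<subseteq>q -` {a}. vanishes_by (redirect q Y c) s \<longleftrightarrow> Y \<inter> B = {}"
      have "N s m = (K - r) choose m" for m
      proof -
        have "N s m = card {X. X \<subseteq> q -` {a} \<and> card X = m \<and> X \<inter> B = {}}"
          unfolding N_def using * by (intro arg_cong[where f = card]) blast
        then show ?thesis using card_subsets_avoiding[OF fin B(1)] K(1) r_def by simp
      qed
      then show ?thesis by simp
    next
      assume *: "\<forall>Y\<subseteq>q -` {a}. vanishes_by (redirect q Y c) s \<longleftrightarrow> B \<subseteq> Y"
      have "N s m = (K - r) choose (K - m)" if "m \<le> K" for m
      proof -
        have "N s m = card {X. X \<subseteq> q -` {a} \<and> card X = m \<and> B \<subseteq> X}"
          unfolding N_def using * by (intro arg_cong[where f = card]) blast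
        then show ?thesis using card_subsets_containing[OF fin B(1)] K(1) r_def that by simp
      qed
      then show ?thesis using that by simp
    qed
    have "N s 1 + N s (K - 1) = ((K - r) choose 1) + ((K - r) choose (K - 1))"
      "N s 2 + N s (K - 2) = ((K - r) choose 2) + ((K - r) choose (K - 2))"
      using K(2) by (intro N; linarith)+
    then show ?thesis
      using choose_balance[OF K(2) r] B_large r_def by metis
  qed
  then show "2 * (N s 2 + N s (K - 2)) \<le> (K - 1) * (N s 1 + N s (K - 1))"
    and "(\<And>Y t. Y \<subseteq> q -` {a} \<Longrightarrow> vanishes_by (redirect q Y c) t \<Longrightarrow> vanishes_by (redirect q Y c) s)
      \<Longrightarrow> 2 * (N s 2 + N s (K - 2)) = (K - 1) * (N s 1 + N s (K - 1))"
    unfolding large_def by blast+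
qed

section \<open>Counting parent maps\<close>

text \<open>The default value \<open>0\<close> off \<open>{1..n}\<close> keeps the set finite and
  makes \<open>0\<close> a sink for the iterates.\<close>

definition vertex_maps :: "nat \<Rightarrow> (nat \<Rightarrow> nat) set" where
  "vertex_maps n = {p. (\<forall>v. v \<notin> {1..n} \<longrightarrow> p v = 0) \<and> (\<forall>v. p v \<le> n)}"

text \<open>
  A rooted tree on \<open>{1..n}\<close> is encoded by its parent map, with \<open>0\<close> standing for the parent of the root.
  Since the degrees sum to \<open>n - 1\<close>, exactly one vertex is mapped to \<open>0\<close>. As \<open>depth\<close> is \<open>1\<close> at the root,
  \<open>vanishes_by p s\<close> means that the height is less than \<open>s\<close>.
\<close>

definition parent_maps :: "nat list \<Rightarrow> nat \<Rightarrow> (nat \<Rightarrow> nat) set" where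
  "parent_maps d s = {p \<in> vertex_maps (length d).
     (\<forall>i\<in>{1..length d}. card (p -` {i}) = d ! (i - 1)) \<and> vanishes_by p s}"

lemma finite_vertex_maps: "finite (vertex_maps n)"
proof -
  have "vertex_maps n \<subseteq> {p. \<forall>v. (v \<in> {1..n} \<longrightarrow> p v \<in> {..n}) \<and> (v \<notin> {1..n} \<longrightarrow> p v = 0)}"
    by (auto simp: vertex_maps_def)
  then show ?thesis using finite_set_of_finite_funs[of "{1..n}" "{..n}" 0] finite_subset by blast
qed

lemma finite_parent_maps [simp]: "finite (parent_maps d s)"
  by (rule finite_subset[OF _ finite_vertex_maps[of "length d"]]) (auto simp: parent_maps_def)

lemma vertex_maps_vimage: "p \<in> vertex_maps n \<Longrightarrow> i \<noteq> 0 \<Longrightarrow> p -` {i} \<subseteq> {1..n}"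
  by (auto simp: vertex_maps_def)

lemma finite_vertex_maps_vimage: "p \<in> vertex_maps n \<Longrightarrow> i \<noteq> 0 \<Longrightarrow> finite (p -` {i})"
  by (rule finite_subset[OF vertex_maps_vimage]) auto

lemma vanishes_by_uniform:
  obtains N where "\<And>p s t. p \<in> vertex_maps n \<Longrightarrow> vanishes_by p t \<Longrightarrow> N \<le> s \<Longrightarrow> vanishes_by p s"
proof -
  \<comment> \<open>As there are finitely many maps, the sum of one bound per map is at least each
    of them; a map without a bound contributes an arbitrary number.\<close>
  define N where "N = (\<Sum>p\<in>vertex_maps n. SOME s. vanishes_by p s)"
  show ?thesis
  proof (rule that[of N])
    fix p s t assume p: "p \<in> vertex_maps n" "vanishes_by p t" "N \<le> s"
    have "(SOME s. vanishes_by p s) \<le> N"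
      unfolding N_def by (rule member_le_sum[OF p(1) _ finite_vertex_maps]) simp
    then show "vanishes_by p s"
      using someI[of "vanishes_by p", OF p(2)] p(3) vanishes_by_mono by (meson le_trans)
  qed
qed

lemma card_parent_maps_eventually:
  obtains N where "\<And>s. N \<le> s \<Longrightarrow> parent_maps d s = parent_maps d N"
proof -
  obtain N where "\<And>p s t. p \<in> vertex_maps (length d) \<Longrightarrow> vanishes_by p t \<Longrightarrow> N \<le> s \<Longrightarrow> vanishes_by p s"
    using vanishes_by_uniform by blast
  then show ?thesis by (intro that[of N]) (auto simp: parent_maps_def intro: vanishes_by_mono)
qed

text \<open>
  The second condition says that \<open>y / x\<close> is the ratio of the total numbers of trees, so the first one
  compares the distribution functions of the heights.
\<close>

definition dominated :: "nat list \<Rightarrow> nat list \<Rightarrow> bool" where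
  "dominated d e \<longleftrightarrow> (\<exists>x y N. x > 0 \<and> y > 0 \<and>
     (\<forall>s. x * card (parent_maps e s) \<le> y * card (parent_maps d s)) \<and>
     (\<forall>s\<ge>N. x * card (parent_maps e s) = y * card (parent_maps d s)))"

lemma dominated_trans:
  assumes "dominated d e" "dominated e f"
  shows "dominated d f"
proof -
  obtain x y N where 1: "x > 0" "y > 0"
     "\<And>s. x * card (parent_maps e s) \<le> y * card (parent_maps d s)"
     "\<And>s. s \<ge> N \<Longrightarrow> x * card (parent_maps e s) = y * card (parent_maps d s)"
    using assms(1) unfolding dominated_def by blast
  obtain x' y' N' where 2: "x' > 0" "y' > 0"
     "\<And>s. x' * card (parent_maps f s) \<le> y' * card (parent_maps e s)"
     "\<And>s. s \<ge> N' \<Longrightarrow> x' * card (parent_maps f s) = y' * card (parent_maps e s)"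
    using assms(2) unfolding dominated_def by blast
  show ?thesis
    unfolding dominated_def
  proof (intro exI conjI allI impI)
    show "x * x' > 0" "y' * y > 0" using 1 2 by auto
    fix s
    have "x * x' * card (parent_maps f s) \<le> x * (y' * card (parent_maps e s))"
      using 2(3)[of s] by (simp add: mult.assoc)
    also have "\<dots> = y' * (x * card (parent_maps e s))" by simp
    also have "\<dots> \<le> y' * y * card (parent_maps d s)"
      using 1(3)[of s] by (simp add: mult.assoc)
    finally show "x * x' * card (parent_maps f s) \<le> y' * y * card (parent_maps d s)" .
  next
    fix s assume "max N N' \<le> s"
    then have "x' * card (parent_maps f s) = y' * card (parent_maps e s)"
      "x * card (parent_maps e s) = y * card (parent_maps d s)"
      using 1(4) 2(4) by auto
    then show "x * x' * card (parent_maps f s) = y' * y * card (parent_maps d s)"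
      by (metis mult.assoc mult.left_commute)
  qed
qed

section \<open>Relabelling the vertices\<close>

text \<open>The exponent is positive because exponent \<open>0\<close> would require
  \<open>\<sigma> (\<tau> v) = v\<close>, while only the other composition is assumed.\<close>

lemma funpow_conjugate:
  assumes "\<And>x. \<tau> (\<sigma> x) = x"
  shows "((\<lambda>v. \<sigma> (p (\<tau> v))) ^^ Suc i) v = \<sigma> ((p ^^ Suc i) (\<tau> v))"
  by (induction i) (auto simp: assms)

lemma vanishes_by_conjugate:
  assumes \<pi>: "\<pi> permutes {1..n}" and "vanishes_by p s"
  shows "vanishes_by (\<lambda>v. \<pi> (p (inv \<pi> v))) s"
proof (cases s)
  case 0
  then have False using assms(2)[unfolded vanishes_by_def, THEN spec, of 1] by simp
  then show ?thesis ..
next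
  case (Suc i)
  have "\<pi> 0 = 0" using permutes_not_in[OF \<pi>] by simp
  moreover have "((\<lambda>v. \<pi> (p (inv \<pi> v))) ^^ Suc i) v = \<pi> ((p ^^ Suc i) (inv \<pi> v))" for v
    by (rule funpow_conjugate) (rule permutes_inverses(2)[OF \<pi>])
  ultimately show ?thesis using assms(2) by (simp only: vanishes_by_def Suc simp_thms)
qed

lemma permutes_Suc_shift:
  assumes "\<pi> permutes {..<n}"
  defines "\<tau> \<equiv> (\<lambda>v. if v \<in> {1..n} then Suc (\<pi> (v - 1)) else v)"
  shows "\<tau> permutes {1..n}"
proof (rule bij_imp_permutes)
  have "bij_betw (\<lambda>v. Suc (\<pi> (v - 1))) {1..n} {1..n}"
  proof -
    have "bij_betw (\<lambda>v. v - 1) {1..n} {..<n}"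
      by (rule bij_betw_byWitness[where f' = Suc]) auto
    moreover have "bij_betw \<pi> {..<n} {..<n}" by (rule permutes_imp_bij[OF assms(1)])
    moreover have "bij_betw Suc {..<n} {1..n}"
      by (rule bij_betw_byWitness[where f' = "\<lambda>v. v - 1"]) auto
    ultimately have "bij_betw (Suc \<circ> (\<pi> \<circ> (\<lambda>v. v - 1))) {1..n} {1..n}"
      by (metis bij_betw_trans)
    then show ?thesis by (simp add: comp_def)
  qed
  then show "bij_betw \<tau> {1..n} {1..n}"
    by (rule bij_betw_cong[THEN iffD1, rotated]) (simp add: \<tau>_def)
qed (auto simp: \<tau>_def)

text \<open>Conjugation by a permutation that matches the two lists is injective on parent maps;
  exchanging the lists then yields equality.\<close>

lemma card_parent_maps_mset_le:
  assumes "mset d = mset e"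
  shows "card (parent_maps d s) \<le> card (parent_maps e s)"
proof -
  define n where "n = length e"
  have n: "length d = n" using assms by (metis n_def size_mset)
  obtain \<rho> where \<rho>: "\<rho> permutes {..<n}" "permute_list \<rho> d = e"
    using mset_eq_permutation[of e d] assms n by metis
  define \<tau> where "\<tau> v = (if v \<in> {1..n} then Suc (\<rho> (v - 1)) else v)" for v
  have \<tau>: "\<tau> permutes {1..n}" unfolding \<tau>_def by (rule permutes_Suc_shift[OF \<rho>(1)])
  \<comment> \<open>Position \<open>i\<close> of \<open>e\<close> carries the entry of
    \<open>d\<close> at position \<open>\<rho> i\<close>. Vertex \<open>\<tau> i\<close> must
    therefore be renamed \<open>i\<close>, which calls for the inverse of
    \<open>\<tau>\<close>.\<close>
  define \<pi> where "\<pi> = inv \<tau>"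
  have \<pi>: "\<pi> permutes {1..n}" unfolding \<pi>_def by (rule permutes_inv[OF \<tau>])
  have inv: "inv \<pi> = \<tau>" "\<And>v. \<pi> (\<tau> v) = v" "\<And>v. \<tau> (\<pi> v) = v"
    unfolding \<pi>_def using permutes_inv_inv[OF \<tau>] permutes_inverses[OF \<tau>] by auto
  define F where "F p = (\<lambda>v. \<pi> (p (\<tau> v)))" for p :: "nat \<Rightarrow> nat"
  have e_nth: "e ! (i - 1) = d ! (\<tau> i - 1)" if "i \<in> {1..n}" for i
    using that permute_list_nth[of \<rho> d "i - 1"] \<rho> n by (auto simp: \<tau>_def)
  have "inj_on F (parent_maps d s)"
  proof (rule inj_onI)
    fix p p' assume "F p = F p'"
    then have "F p (\<pi> v) = F p' (\<pi> v)" for v by simp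
    then show "p = p'" unfolding F_def fun_eq_iff by (metis inv(3))
  qed
  moreover have "F p \<in> parent_maps e s" if p: "p \<in> parent_maps d s" for p
  proof -
    have "F p \<in> vertex_maps n"
    proof -
      have "p v \<in> {0..n}" for v using p n by (auto simp: parent_maps_def vertex_maps_def)
      then have "\<pi> (p v) \<in> {0..n}" for v
        using permutes_in_image[OF \<pi>, of "p v"] permutes_not_in[OF \<pi>, of 0]
        by (metis atLeastAtMost_iff gr0I less_one linorder_not_less zero_le)
      moreover have "F p v = 0" if "v \<notin> {1..n}" for v
      proof -
        have "\<tau> v = v" using that by (auto simp: \<tau>_def)
        moreover have "p v = 0" using p n that by (auto simp: parent_maps_def vertex_maps_def)
        ultimately show ?thesis using permutes_not_in[OF \<pi>, of 0] by (simp add: F_def)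
      qed
      ultimately show ?thesis by (auto simp: vertex_maps_def F_def)
    qed
    moreover have "card (F p -` {i}) = e ! (i - 1)" if "i \<in> {1..n}" for i
    proof -
      have "F p -` {i} = \<pi> ` (p -` {\<tau> i})"
      proof (intro set_eqI iffI)
        fix x assume "x \<in> F p -` {i}"
        then have "\<tau> (\<pi> (p (\<tau> x))) = \<tau> i" by (simp add: F_def)
        then show "x \<in> \<pi> ` (p -` {\<tau> i})"
          by (intro image_eqI[of _ _ "\<tau> x"]) (simp_all add: inv(2,3))
      next
        fix x assume "x \<in> \<pi> ` (p -` {\<tau> i})"
        then show "x \<in> F p -` {i}" by (auto simp: F_def inv(2,3))
      qed
      then have "card (F p -` {i}) = card (p -` {\<tau> i})"
        by (simp add: card_image inj_on_subset[OF permutes_inj[OF \<pi>]])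
      also have "card (p -` {\<tau> i}) = d ! (\<tau> i - 1)"
        using p n permutes_in_image[OF \<tau>, of i] that by (simp add: parent_maps_def)
      finally show ?thesis using e_nth[OF that] by simp
    qed
    moreover have "vanishes_by (F p) s"
      using vanishes_by_conjugate[OF \<pi>, of p s] p by (simp add: F_def inv parent_maps_def)
    ultimately show ?thesis by (simp add: parent_maps_def n_def)
  qed
  ultimately show ?thesis by (intro card_inj_on_le[of F]) auto
qed

lemma card_parent_maps_mset: "mset d = mset e \<Longrightarrow> card (parent_maps d s) = card (parent_maps e s)"
  using card_parent_maps_mset_le[of d e s] card_parent_maps_mset_le[of e d s] by simp

lemma dominated_mset:
  assumes "mset d = mset e"
  shows "dominated d e"
proof -
  have "card (parent_maps e s) = card (parent_maps d s)" for s
    by (rule card_parent_maps_mset) (rule assms[symmetric])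
  then show ?thesis
    unfolding dominated_def by (intro exI[of _ "1::nat"] exI[of _ "0::nat"] conjI) simp_all
qed

section \<open>Distributing the pooled children of two vertices\<close>

lemma parent_maps_Cons_Cons:
  "p \<in> parent_maps (k # l # r) s \<longleftrightarrow> p \<in> vertex_maps (length r + 2) \<and> card (p -` {1}) = k \<and>
     card (p -` {2}) = l \<and> (\<forall>i<length r. card (p -` {i + 3}) = r ! i) \<and> vanishes_by p s"
proof -
  have "(\<forall>i\<in>{1..length (k # l # r)}. P i ((k # l # r) ! (i - 1))) \<longleftrightarrow>
    P 1 k \<and> P 2 l \<and> (\<forall>i<length r. P (i + 3) (r ! i))" for P :: "nat \<Rightarrow> nat \<Rightarrow> bool"
  proof -
    have "{1..length (k # l # r)} = {1, 2} \<union> (\<lambda>i. i + 3) ` {..<length r}"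
    proof (intro set_eqI iffI)
      fix x assume "x \<in> {1..length (k # l # r)}"
      then have "x = 1 \<or> x = 2 \<or> x - 3 < length r \<and> x = x - 3 + 3" by auto
      then show "x \<in> {1, 2} \<union> (\<lambda>i. i + 3) ` {..<length r}" by blast
    qed auto
    then show ?thesis by (auto simp: numeral_3_eq_3)
  qed
  from this[of "\<lambda>i m. card (p -` {i}) = m"] show ?thesis by (simp add: parent_maps_def)
qed

text \<open>Parent maps in which the children of the vertices \<open>1\<close> and \<open>2\<close> have all been given to \<open>1\<close>.\<close>

definition merged_maps :: "nat \<Rightarrow> nat list \<Rightarrow> (nat \<Rightarrow> nat) set" where
  "merged_maps K r = {q \<in> vertex_maps (length r + 2). 2 \<notin> range q \<and> card (q -` {1}) = K \<and>
     (\<forall>i<length r. card (q -` {i + 3}) = r ! i)}"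

lemma finite_merged_maps: "finite (merged_maps K r)"
  by (rule finite_subset[OF _ finite_vertex_maps[of "length r + 2"]]) (auto simp: merged_maps_def)

lemma redirect_in_vertex_maps:
  assumes "q \<in> vertex_maps n" "X \<subseteq> q -` {a}" "a \<noteq> 0" "c \<le> n"
  shows "redirect q X c \<in> vertex_maps n"
proof -
  have "X \<subseteq> {1..n}" using vertex_maps_vimage[OF assms(1,3)] assms(2) by blast
  then have "v \<notin> X" if "v \<notin> {1..n}" for v using that by blast
  then show ?thesis using assms(1,4) by (simp add: vertex_maps_def redirect_def)
qed

text \<open>Merging the children of \<open>1\<close> and \<open>2\<close> loses just the set of
  children of \<open>2\<close>. The range of summation depends on \<open>k\<close> and
  \<open>l\<close> only through \<open>k + l\<close>, so different splits of one total are compared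
  over the same merged maps.\<close>

lemma card_parent_maps_eq_sum:
  "card (parent_maps (k # l # r) s) = (\<Sum>q\<in>merged_maps (k + l) r.
     card {X. X \<subseteq> q -` {1} \<and> card X = l \<and> vanishes_by (redirect q X 2) s})"
proof -
  define A where "A q = {X. X \<subseteq> q -` {1} \<and> card X = l \<and> vanishes_by (redirect q X 2) s}"
    for q :: "nat \<Rightarrow> nat"
  define G where "G z = redirect (fst z) (snd z) 2" for z :: "(nat \<Rightarrow> nat) \<times> nat set"
  define M where "M p = (\<lambda>v. if p v = 2 then 1 else p v)" for p :: "nat \<Rightarrow> nat"
  have redirect_M: "redirect (M p) (p -` {2}) 2 = p" for p
    by (auto simp: fun_eq_iff redirect_def M_def)
  have "bij_betw G (Sigma (merged_maps (k + l) r) A) (parent_maps (k # l # r) s)"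
  proof (rule bij_betw_byWitness[where f' = "\<lambda>p. (M p, p -` {2})"])
    show "\<forall>z\<in>Sigma (merged_maps (k + l) r) A. (M (G z), G z -` {2}) = z"
    proof
      fix z assume "z \<in> Sigma (merged_maps (k + l) r) A"
      then obtain q X where z: "z = (q, X)" and q: "q \<in> merged_maps (k + l) r" and X: "X \<in> A q"
        by blast
      have "q v \<noteq> 2" for v using q by (auto simp: merged_maps_def)
      then have "M (redirect q X 2) = q" "redirect q X 2 -` {2} = X"
        using X by (auto simp: M_def A_def redirect_def fun_eq_iff split: if_splits)
      then show "(M (G z), G z -` {2}) = z" by (simp add: G_def z)
    qed
    show "\<forall>p\<in>parent_maps (k # l # r) s. G (M p, p -` {2}) = p"
      by (simp add: G_def redirect_M)
    show "G ` Sigma (merged_maps (k + l) r) A \<subseteq> parent_maps (k # l # r) s"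
    proof (rule image_subsetI)
      fix z assume "z \<in> Sigma (merged_maps (k + l) r) A"
      then obtain q X where z: "z = (q, X)" and q: "q \<in> merged_maps (k + l) r" and X: "X \<in> A q"
        by blast
      have q2: "q v \<noteq> 2" for v using q by (auto simp: merged_maps_def)
      have qv: "q \<in> vertex_maps (length r + 2)" using q by (simp add: merged_maps_def)
      have fin: "finite (q -` {1})" by (rule finite_vertex_maps_vimage[OF qv]) simp
      have XS: "X \<subseteq> q -` {1}" using X by (simp add: A_def)
      define p where "p = redirect q X 2"
      have "p -` {1} = q -` {1} - X" by (auto simp: p_def redirect_def split: if_splits)
      then have "card (p -` {1}) = k"
        using X q XS finite_subset[OF XS fin] by (simp add: card_Diff_subset A_def merged_maps_def)
      moreover have "p -` {2} = X" using q2 by (auto simp: p_def redirect_def split: if_splits)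
      moreover have "p -` {i + 3} = q -` {i + 3}" for i
        using XS by (auto simp: p_def redirect_def split: if_splits)
      moreover have "p \<in> vertex_maps (length r + 2)"
        unfolding p_def by (rule redirect_in_vertex_maps[OF qv XS]) simp_all
      ultimately have "p \<in> parent_maps (k # l # r) s"
        unfolding parent_maps_Cons_Cons using q X by (auto simp: A_def merged_maps_def p_def)
      then show "G z \<in> parent_maps (k # l # r) s" by (simp add: G_def p_def z)
    qed
    show "(\<lambda>p. (M p, p -` {2})) ` parent_maps (k # l # r) s \<subseteq> Sigma (merged_maps (k + l) r) A"
    proof (rule image_subsetI)
      fix p assume "p \<in> parent_maps (k # l # r) s"
      then have p: "p \<in> vertex_maps (length r + 2)" "card (p -` {1}) = k" "card (p -` {2}) = l"
        "\<forall>i<length r. card (p -` {i + 3}) = r ! i" "vanishes_by p s"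
        unfolding parent_maps_Cons_Cons by auto
      have "M p -` {1} = p -` {1} \<union> p -` {2}" by (auto simp: M_def split: if_splits)
      moreover have "card (p -` {1} \<union> p -` {2}) = card (p -` {1}) + card (p -` {2})"
        by (rule card_Un_disjoint) (auto intro!: finite_vertex_maps_vimage[OF p(1)])
      ultimately have "card (M p -` {1}) = k + l" "p -` {2} \<subseteq> M p -` {1}" using p by auto
      moreover have "M p -` {i + 3} = p -` {i + 3}" for i by (auto simp: M_def split: if_splits)
      moreover have "M p \<in> vertex_maps (length r + 2)"
        using p(1) by (auto simp: vertex_maps_def M_def)
      moreover have "2 \<notin> range (M p)" by (auto simp: M_def split: if_splits)
      ultimately show "(M p, p -` {2}) \<in> Sigma (merged_maps (k + l) r) A"
        using p by (simp add: merged_maps_def A_def redirect_M)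
    qed
  qed
  then have "card (parent_maps (k # l # r) s) = card (Sigma (merged_maps (k + l) r) A)"
    by (simp add: bij_betw_same_card)
  also have "\<dots> = (\<Sum>q\<in>merged_maps (k + l) r. card (A q))"
  proof (rule card_SigmaI[OF finite_merged_maps])
    have "finite (A q)" if "q \<in> merged_maps (k + l) r" for q
    proof (rule finite_subset)
      show "A q \<subseteq> Pow (q -` {1})" by (auto simp: A_def)
      show "finite (Pow (q -` {1}))"
        using finite_vertex_maps_vimage[of q "length r + 2" 1] that by (simp add: merged_maps_def)
    qed
    then show "\<forall>q\<in>merged_maps (k + l) r. finite (A q)" by blast
  qed
  finally show ?thesis by (simp add: A_def)
qed

text \<open>The comparison holds for each merged map separately and is then summed. The pooled
  number of children is \<open>k + 1\<close>, so \<open>k \<ge> 3\<close> is what the balance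
  inequality asks for.\<close>

lemma dominated_balance:
  assumes "k \<ge> 3"
  shows "dominated (k # 1 # r) ((k - 1) # 2 # r)"
proof -
  define N where "N s l q = card {X. X \<subseteq> q -` {1} \<and> card X = l \<and> vanishes_by (redirect q X 2) s}"
    for s l and q :: "nat \<Rightarrow> nat"
  define M where "M = merged_maps (k + 1) r"
  have cnt: "card (parent_maps (i # j # r) s) = (\<Sum>q\<in>M. N s j q)" if "i + j = k + 1" for i j s
    unfolding card_parent_maps_eq_sum that M_def N_def ..
  \<comment> \<open>Exchanging the vertices \<open>1\<close> and \<open>2\<close> turns twice each
    count into the symmetrised sum that the balance inequality controls.\<close>
  have sym: "card (parent_maps (i # j # r) s) = card (parent_maps (j # i # r) s)" for i j s
    by (rule card_parent_maps_mset) simp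
  have one: "2 * card (parent_maps (k # 1 # r) s) = (\<Sum>q\<in>M. N s 1 q + N s k q)" for s
    using cnt[of k 1 s] cnt[of 1 k s] sym[of k 1 s] by (simp add: sum.distrib)
  have two: "2 * card (parent_maps ((k - 1) # 2 # r) s) = (\<Sum>q\<in>M. N s 2 q + N s (k - 1) q)" for s
    using cnt[of "k - 1" 2 s] cnt[of 2 "k - 1" s] sym[of "k - 1" 2 s] assms by (simp add: sum.distrib)
  have M: "q \<in> vertex_maps (length r + 2)" "2 \<notin> range q" "card (q -` {1}) = k + 1" "finite (q -` {1})"
    if "q \<in> M" for q
    using that finite_vertex_maps_vimage[of q "length r + 2" 1] by (auto simp: M_def merged_maps_def)
  have le: "2 * (N s 2 q + N s (k - 1) q) \<le> k * (N s 1 q + N s k q)" if "q \<in> M" for s q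
    using card_vanishing_balance(1)[OF _ _ M(2)[OF that] M(4)[OF that] M(3)[OF that], of s] assms
    by (simp add: N_def)
  \<comment> \<open>From \<open>S\<close> on no acyclic redirection fails merely because of its
    height, which is the condition for equality.\<close>
  obtain S where S: "\<And>p s t. p \<in> vertex_maps (length r + 2) \<Longrightarrow> vanishes_by p t \<Longrightarrow> S \<le> s \<Longrightarrow> vanishes_by p s"
    using vanishes_by_uniform[of "length r + 2"] by blast
  have eq: "2 * (N s 2 q + N s (k - 1) q) = k * (N s 1 q + N s k q)" if "q \<in> M" "S \<le> s" for s q
  proof -
    have "vanishes_by (redirect q Y 2) s" if "Y \<subseteq> q -` {1}" "vanishes_by (redirect q Y 2) t" for Y t
      using S[OF redirect_in_vertex_maps[OF M(1)[OF \<open>q \<in> M\<close>] that(1)] that(2) \<open>S \<le> s\<close>] by simp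
    then show ?thesis
      using card_vanishing_balance(2)[OF _ _ M(2)[OF that(1)] M(4)[OF that(1)] M(3)[OF that(1)], of s] assms
      by (simp add: N_def)
  qed
  show ?thesis
    unfolding dominated_def
  proof (intro exI conjI allI impI)
    \<comment> \<open>The witnesses are the coefficients of the balance inequality: the total
      numbers of trees after and before balancing are as \<open>k\<close> to
      \<open>2\<close>.\<close>
    show "(2::nat) > 0" "k > 0" using assms by auto
    fix s
    have "2 * (2 * card (parent_maps ((k - 1) # 2 # r) s)) \<le> k * (2 * card (parent_maps (k # 1 # r) s))"
      unfolding one two sum_distrib_left by (rule sum_mono) (rule le)
    then show "2 * card (parent_maps ((k - 1) # 2 # r) s) \<le> k * card (parent_maps (k # 1 # r) s)"
      by simp
  next
    fix s assume "S \<le> s"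
    have "2 * (2 * card (parent_maps ((k - 1) # 2 # r) s)) = k * (2 * card (parent_maps (k # 1 # r) s))"
      unfolding one two sum_distrib_left by (rule sum.cong[OF refl]) (rule eq[OF _ \<open>S \<le> s\<close>])
    then show "2 * card (parent_maps ((k - 1) # 2 # r) s) = k * card (parent_maps (k # 1 # r) s)"
      by simp
  qed
qed

section \<open>Inserting a unary vertex\<close>

lemma card_vimage_transpose:
  assumes "\<And>x. f x = i \<longleftrightarrow> g (Transposition.transpose u v x) = i"
  shows "card (f -` {i}) = card (g -` {i})"
proof -
  have "f -` {i} = Transposition.transpose u v -` (g -` {i})" using assms by auto
  then show ?thesis by (simp add: card_vimage_inj)
qed

text \<open>Contracting the last vertex, which is unary, never increases the height. The contracted
  map and the only child of the removed vertex determine the original map.\<close>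

lemma card_parent_maps_append_1_le:
  "card (parent_maps (d @ [1]) s) \<le> length d * card (parent_maps d s)"
proof -
  define n where "n = length d"
  define W where "W q = (THE w. q w = n + 1)" for q :: "nat \<Rightarrow> nat"
  define H where "H q = (\<lambda>v. if v = n + 1 then 0 else if v = W q then q (n + 1) else q v)"
    for q :: "nat \<Rightarrow> nat"
  define G where "G p w = (\<lambda>v. if v = n + 1 then p w else if v = w then n + 1 else p v)"
    for p :: "nat \<Rightarrow> nat" and w
  have *: "G (H q) (W q) = q \<and> W q \<in> {1..n} \<and> H q \<in> parent_maps d s"
    if q: "q \<in> parent_maps (d @ [1]) s" for q
  proof -
    have van: "vanishes_by q s" and qv: "q \<in> vertex_maps (n + 1)" using q by (auto simp: parent_maps_def n_def)
    have deg: "card (q -` {i}) = (d @ [1]) ! (i - 1)" if "i \<in> {1..n + 1}" for i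
      using q that by (simp add: parent_maps_def n_def)
    have "card (q -` {n + 1}) = 1" using deg[of "n + 1"] by (simp add: n_def)
    then obtain w where w: "q -` {n + 1} = {w}" by (rule card_1_singletonE)
    then have qw: "q v = n + 1 \<longleftrightarrow> v = w" for v by auto
    then have qw_w: "q w = n + 1" by simp
    have W: "W q = w" unfolding W_def by (rule the_equality) (simp_all only: qw)
    have wn: "w \<noteq> n + 1"
      using vanishes_by_no_cycle[OF van, of 0 "n + 1"] qw by auto
    have "w \<in> {1..n + 1}" using vertex_maps_vimage[OF qv, of "n + 1"] w by auto
    then have w_in: "w \<in> {1..n}" using wn by auto
    have "G (H q) (W q) = q"
      using wn qw[of w] by (auto simp: fun_eq_iff G_def H_def W)
    moreover have "H q \<in> vertex_maps n"
    proof -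
      have "q v \<le> n + 1" and q0: "v \<notin> {1..n + 1} \<Longrightarrow> q v = 0" for v
        using qv by (auto simp: vertex_maps_def)
      then have "q v \<le> n" if "v \<noteq> w" for v
        using qw[of v] that by (metis Suc_eq_plus1 le_SucE)
      then have "H q v \<le> n" for v
        using wn by (simp add: H_def W)
      moreover have "H q v = 0" if "v \<notin> {1..n}" for v
        using that w_in q0[of v] by (auto simp: H_def W)
      ultimately show ?thesis by (simp add: vertex_maps_def)
    qed
    moreover have "card (H q -` {i}) = d ! (i - 1)" if "i \<in> {1..n}" for i
    proof -
      \<comment> \<open>The vertex \<open>w\<close> inherits the value of \<open>n + 1\<close>,
        while \<open>H q (n + 1) = 0\<close> and \<open>q w = n + 1\<close> both lie outside
        \<open>{1..n}\<close>; so the fibres correspond under the transposition.\<close>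
      have "card (H q -` {i}) = card (q -` {i})"
        by (rule card_vimage_transpose[of _ _ _ w "n + 1"])
          (use that qw_w wn in \<open>auto simp: H_def W Transposition.transpose_def\<close>)
      also have "\<dots> = d ! (i - 1)" using deg[of i] that by (auto simp: nth_append n_def)
      finally show ?thesis .
    qed
    moreover have "vanishes_by (H q) s"
    proof (rule vanishes_by_rank[where rk = "depth q"])
      show "H q 0 = 0" using w_in vanishes_by_fixes_0[OF van] by (simp add: H_def W)
    next
      fix v :: nat assume "v \<noteq> 0"
      then show "depth q (H q v) < depth q v"
        using depth_Suc[OF van, of v] depth_Suc[OF van, of "n + 1"] qw_w
        by (auto simp: H_def W)
    qed (rule depth_le[OF van])
    ultimately show ?thesis using w_in by (simp add: W parent_maps_def n_def)
  qed
  have "inj_on (\<lambda>q. (H q, W q)) (parent_maps (d @ [1]) s)"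
    by (rule inj_on_inverseI[where g = "\<lambda>(p, w). G p w"]) (use * in auto)
  moreover have "(\<lambda>q. (H q, W q)) ` parent_maps (d @ [1]) s \<subseteq> parent_maps d s \<times> {1..n}"
    using * by auto
  ultimately have "card (parent_maps (d @ [1]) s) \<le> card (parent_maps d s \<times> {1..n})"
    by (rule card_inj_on_le) simp
  then show ?thesis by (simp add: card_cartesian_product n_def mult.commute)
qed

text \<open>The inverse construction puts the new vertex directly above an arbitrary vertex
  \<open>w\<close>. The doubled bound is crude, but is applied only where the height restriction is
  void.\<close>

lemma card_parent_maps_append_1_ge:
  "length d * card (parent_maps d s) \<le> card (parent_maps (d @ [1]) (2 * s))"
proof -
  define n where "n = length d"
  define G where "G = (\<lambda>(p, w) v. if v = n + 1 then p w else if v = w then n + 1 else p v :: nat)"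
  have G: "G (p, w) v = (if v = n + 1 then p w else if v = w then n + 1 else p v)" for p w v
    by (simp add: G_def)
  have "inj_on G (parent_maps d s \<times> {1..n})"
  proof (rule inj_onI)
    fix z z' assume z: "z \<in> parent_maps d s \<times> {1..n}" "z' \<in> parent_maps d s \<times> {1..n}" "G z = G z'"
    obtain p w p' w' where eq: "z = (p, w)" "z' = (p', w')" by (cases z, cases z')
    have "p \<in> vertex_maps n" "p' \<in> vertex_maps n"
      using z eq by (simp_all add: parent_maps_def n_def)
    then have le: "p v \<le> n" "p' v \<le> n" and bound: "p (n + 1) = 0" "p' (n + 1) = 0" for v
      by (simp_all add: vertex_maps_def)
    have ne: "p v \<noteq> n + 1" "p' v \<noteq> n + 1" for v using le[of v] by simp_all
    have pt: "G (p, w) v = G (p', w') v" for v using z(3) eq by simp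
    have "w = w'"
    proof -
      have "w \<noteq> n + 1" using z(1) eq by auto
      then have "G (p', w') w = n + 1" using pt[of w] by (simp add: G)
      then show ?thesis using ne by (auto simp: G split: if_splits)
    qed
    moreover have "p v = p' v" for v
    proof (cases "v = w \<or> v = n + 1")
      case True
      then show ?thesis using pt[of "n + 1"] \<open>w = w'\<close> bound by (auto simp: G)
    next
      case False
      then show ?thesis using pt[of v] \<open>w = w'\<close> by (auto simp: G)
    qed
    ultimately show "z = z'" by (auto simp: eq)
  qed
  moreover have "G ` (parent_maps d s \<times> {1..n}) \<subseteq> parent_maps (d @ [1]) (2 * s)"
  proof (rule image_subsetI)
    fix z assume "z \<in> parent_maps d s \<times> {1..n}"
    then obtain p w where z: "z = (p, w)" and p: "p \<in> parent_maps d s" and w: "w \<in> {1..n}" by blast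
    have van: "vanishes_by p s" and pv: "p \<in> vertex_maps n" using p by (auto simp: parent_maps_def n_def)
    have p_le: "p v \<le> n" for v using pv by (simp add: vertex_maps_def)
    have p_out: "p v = 0" if "v \<notin> {1..n}" for v using pv that by (auto simp: vertex_maps_def)
    have p_ne: "p v \<noteq> n + 1" for v using p_le[of v] by simp
    define q where "q = G (p, w)"
    have q: "q v = (if v = n + 1 then p w else if v = w then n + 1 else p v)" for v
      by (simp add: q_def G)
    have "q \<in> vertex_maps (n + 1)"
      using p_le p_out w by (auto simp: vertex_maps_def q le_SucI)
    moreover have "card (q -` {i}) = (d @ [1]) ! (i - 1)" if i: "i \<in> {1..n + 1}" for i
    proof (cases "i = n + 1")
      case True
      have "q -` {n + 1} = {w}" using p_ne w by (auto simp: q split: if_splits)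
      then show ?thesis by (simp add: True n_def)
    next
      case False
      then have i': "i \<in> {1..n}" using i by auto
      have "card (q -` {i}) = card (p -` {i})"
        by (rule card_vimage_transpose[of _ _ _ w "n + 1"])
          (use False i' w p_out in \<open>auto simp: q Transposition.transpose_def\<close>)
      also have "\<dots> = d ! (i - 1)" using p i' by (auto simp: parent_maps_def n_def)
      also have "\<dots> = (d @ [1]) ! (i - 1)" using i' by (auto simp: nth_append n_def)
      finally show ?thesis .
    qed
    moreover have "vanishes_by q (2 * s)"
    \<comment> \<open>Doubling the depths leaves an odd value free for the new vertex between
      \<open>w\<close> and its parent.\<close>
    proof (rule vanishes_by_rank[where rk = "\<lambda>v. if v = n + 1 then 2 * depth p w - 1 else 2 * depth p v"])
      show "q 0 = 0" using w vanishes_by_fixes_0[OF van] by (simp add: q)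
    next
      fix v :: nat assume v: "v \<noteq> 0"
      have "w \<noteq> 0" "w \<noteq> n + 1" using w by auto
      then show "(if q v = n + 1 then 2 * depth p w - 1 else 2 * depth p (q v))
          < (if v = n + 1 then 2 * depth p w - 1 else 2 * depth p v)"
        using depth_Suc[OF van v] depth_Suc[OF van \<open>w \<noteq> 0\<close>] p_ne by (simp add: q)
    next
      fix v show "(if v = n + 1 then 2 * depth p w - 1 else 2 * depth p v) \<le> 2 * s"
        using depth_le[OF van, of v] depth_le[OF van, of w] by auto
    qed
    ultimately show "G z \<in> parent_maps (d @ [1]) (2 * s)" by (simp add: z q_def parent_maps_def n_def)
  qed
  ultimately have "card (parent_maps d s \<times> {1..n}) \<le> card (parent_maps (d @ [1]) (2 * s))"
    by (rule card_inj_on_le) simp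
  then show ?thesis by (simp add: card_cartesian_product n_def mult.commute)
qed

text \<open>Each tree has \<open>length d\<close> places for a new unary vertex, one above every
  vertex, the root included. Contraction gives the inequality for every height; for large
  \<open>s\<close> the two estimates meet.\<close>

lemma dominated_append_1:
  assumes "d \<noteq> []"
  shows "dominated d (d @ [1])"
proof -
  obtain N where N: "\<And>s. N \<le> s \<Longrightarrow> parent_maps d s = parent_maps d N"
    using card_parent_maps_eventually[of d] by blast
  obtain N' where N': "\<And>s. N' \<le> s \<Longrightarrow> parent_maps (d @ [1]) s = parent_maps (d @ [1]) N'"
    using card_parent_maps_eventually[of "d @ [1]"] by blast
  have "length d * card (parent_maps d s) \<le> card (parent_maps (d @ [1]) s)" if s: "max N N' \<le> s" for s
  proof -
    have "parent_maps (d @ [1]) (2 * s) = parent_maps (d @ [1]) s"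
      using N'[of s] N'[of "2 * s"] s by simp
    then show ?thesis using card_parent_maps_append_1_ge[of d s] by simp
  qed
  then have "card (parent_maps (d @ [1]) s) = length d * card (parent_maps d s)" if "max N N' \<le> s" for s
    using card_parent_maps_append_1_le[of d s] that by (meson le_antisym)
  then show ?thesis
    unfolding dominated_def using card_parent_maps_append_1_le[of d] assms
    by (intro exI[of _ "1::nat"] exI[of _ "length d"] exI[of _ "max N N'"]) simp
qed

section \<open>Reduction to a sub-binary sequence\<close>

lemma sum_list_eq_of_counts:
  assumes "\<forall>x\<in>set xs. x \<le> 2"
  shows "sum_list xs = count_list xs 1 + 2 * count_list xs 2"
    and "length xs = count_list xs 0 + count_list xs 1 + count_list xs 2"
  using assms by (induction xs) (auto simp: le_Suc_eq numeral_2_eq_2)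

text \<open>Since the sum is one less than the length, the number of entries \<open>2\<close> is one
  less than the number of entries \<open>0\<close>.\<close>

lemma mset_eq_if_sub_binary:
  assumes "degree_sequence b" "\<forall>x\<in>set b. x \<le> 2" "degree_sequence d" "\<forall>x\<in>set d. x \<le> 2"
    and "count_list d 0 = count_list b 0" "count_list d 1 = count_list b 1"
  shows "mset d = mset b"
proof (rule multiset_eqI)
  fix x
  have "count_list d 2 = count_list b 2"
    using sum_list_eq_of_counts[OF assms(2)] sum_list_eq_of_counts[OF assms(4)] assms(1,3,5,6)
    by (simp add: degree_sequence_def)
  moreover have "count_list d x = count_list b x" if "x > 2"
    using that assms(2,4) by (metis count_notin not_less)
  ultimately have "count_list d x = count_list b x"
    using assms(5,6) by (metis One_nat_def less_2_cases_iff linorder_neqE_nat)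
  then show "count (mset d) x = count (mset b) x" by (simp add: count_mset)
qed

text \<open>Induction on the total excess over \<open>2\<close>; truncated subtraction lets small
  entries count as \<open>0\<close>. Replacing \<open>k\<close> by \<open>k - 1\<close> and
  \<open>2\<close> lowers the excess by one and keeps the numbers of entries \<open>0\<close> and
  \<open>1\<close>, because \<open>k - 1 \<ge> 2\<close>.\<close>

lemma dominated_sub_binary:
  assumes "degree_sequence b" "sub_binary b" "degree_sequence d"
    and "count_list d 0 = count_list b 0" "count_list d 1 = count_list b 1"
  shows "dominated d b"
  using assms(3-)
proof (induction "sum_list (map (\<lambda>x. x - 2) d)" arbitrary: d rule: less_induct)
  case less
  have b2: "\<forall>x\<in>set b. x \<le> 2"
    using assms(2) by (auto simp: sub_binary_def count_list_0_iff not_less_eq_eq[symmetric] numeral_3_eq_3 numeral_2_eq_2)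
  show ?case
  proof (cases "\<forall>x\<in>set d. x \<le> 2")
    case True
    then show ?thesis using dominated_mset mset_eq_if_sub_binary assms(1) b2 less.prems by blast
  next
    case False
    then obtain k where k: "k \<in> set d" "k \<ge> 3" by force
    then obtain xs ys where d: "d = xs @ k # ys" by (meson split_list)
    define r where "r = xs @ ys"
    define e where "e = (k - 1) # 2 # r"
    note dominated_trans [trans]
    \<comment> \<open>The appended \<open>1\<close> is consumed by the balancing step, which turns
      \<open>(k, 1)\<close> into \<open>(k - 1, 2)\<close>; the other steps only rearrange the
      entries.\<close>
    have "dominated d (k # r)" by (rule dominated_mset) (simp add: d r_def)
    also have "dominated (k # r) ((k # r) @ [1])" by (rule dominated_append_1) simp
    also have "dominated ((k # r) @ [1]) (k # 1 # r)" by (rule dominated_mset) simp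
    also have "dominated (k # 1 # r) e" unfolding e_def by (rule dominated_balance[OF k(2)])
    finally have "dominated d e" .
    moreover have "dominated e b"
    proof (rule less.hyps)
      show "sum_list (map (\<lambda>x. x - 2) e) < sum_list (map (\<lambda>x. x - 2) d)"
        using k(2) by (simp add: e_def d r_def)
      show "degree_sequence e"
        using less.prems(1) k(2) by (simp add: e_def d r_def degree_sequence_def)
      show "count_list e 0 = count_list b 0" "count_list e 1 = count_list b 1"
        using less.prems(2,3) k(2) by (auto simp: e_def d r_def)
    qed
    ultimately show ?thesis by (rule dominated_trans)
  qed
qed

section \<open>Trees and parent maps\<close>

lemma awalk_with_proj:
  "pre_digraph.awalk (with_proj G) u p v \<longleftrightarrow> u \<in> pverts G \<and> set p \<subseteq> parcs G \<and> pcas u p v"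
  by (simp add: pre_digraph.awalk_def cas_with_proj_eq)

lemma cycle_with_proj:
  "pre_digraph.cycle (with_proj G) p \<longleftrightarrow>
    (\<exists>u. pre_digraph.awalk (with_proj G) u p u \<and> distinct (tl (pawalk_verts u p)) \<and> p \<noteq> [])"
  by (simp add: pre_digraph.cycle_def awalk_verts_with_proj_eq)

lemma pcas_append: "pcas u (p @ q) v \<longleftrightarrow> (\<exists>w. pcas u p w \<and> pcas w q v)"
  by (induction p arbitrary: u) auto

lemma tl_pawalk_verts: "pcas u p v \<Longrightarrow> tl (pawalk_verts u p) = map snd p"
proof (induction p arbitrary: u)
  case (Cons e p)
  then show ?case by (cases p) auto
qed simp

lemma pcas_last: "pcas u p v \<Longrightarrow> p \<noteq> [] \<Longrightarrow> snd (last p) = v"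
  by (induction p arbitrary: u) auto

lemma pair_graphI:
  assumes "finite (pverts G)" "parcs G \<subseteq> pverts G \<times> pverts G" "sym (parcs G)"
    and "\<And>v. (v, v) \<notin> parcs G"
  shows "pair_graph G"
proof -
  have "finite (parcs G)" using assms(1,2) finite_subset by blast
  then show ?thesis
    using assms by unfold_locales (auto simp: symmetric_def)
qed

lemma graph_dist_le: "pre_digraph.awalk (with_proj G) u p v \<Longrightarrow> graph_dist G u v \<le> length p"
  unfolding graph_dist_def by (rule Least_le) blast

lemma graph_dist_witness:
  assumes "pre_digraph.awalk (with_proj G) u p v"
  obtains q where "pre_digraph.awalk (with_proj G) u q v" "length q = graph_dist G u v"
proof -
  have "\<exists>q. pre_digraph.awalk (with_proj G) u q v \<and> length q = graph_dist G u v"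
    unfolding graph_dist_def by (rule LeastI[of _ "length p"]) (use assms in blast)
  then show ?thesis using that by blast
qed

text \<open>Connectedness is defined through the symmetric closure, and a \<open>pair_graph\<close>
  is its own symmetric closure.\<close>

lemma connected_iff_awalk:
  assumes "pair_graph G"
  shows "Digraph_Component.connected (with_proj G) \<longleftrightarrow>
    pverts G \<noteq> {} \<and> (\<forall>u\<in>pverts G. \<forall>v\<in>pverts G. \<exists>p. pre_digraph.awalk (with_proj G) u p v)"
proof -
  interpret pair_graph G by fact
  have "mk_symmetric (with_proj G) = G"
    using arcs_symmetric by (intro pair_pre_digraph.equality) (auto simp: mk_symmetric_def)
  then show ?thesis
    by (simp add: connected_def strongly_connected_def reachable_awalk)
qed

section \<open>The tree of a parent map\<close>

text \<open>Excluding \<open>0\<close> drops the link from the root to its artificial parent. For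
  maps in \<open>vertex_maps\<close> it also discards every number that is not a vertex.\<close>

definition parent_arcs :: "(nat \<Rightarrow> nat) \<Rightarrow> (nat \<times> nat) set" where
  "parent_arcs p = {(v, w). v \<noteq> 0 \<and> w \<noteq> 0 \<and> (p v = w \<or> p w = v)}"

definition tree_of :: "nat \<Rightarrow> (nat \<Rightarrow> nat) \<Rightarrow> nat rooted_graph" where
  "tree_of n p = (\<lparr>pverts = {1..n}, parcs = parent_arcs p\<rparr>, THE r. r \<in> {1..n} \<and> p r = 0)"

lemma parent_arcs_sym: "(v, w) \<in> parent_arcs p \<Longrightarrow> (w, v) \<in> parent_arcs p"
  by (auto simp: parent_arcs_def)

text \<open>The vertices with nonzero parent are partitioned by the fibres over
  \<open>{1..n}\<close>, whose sizes sum to \<open>n - 1\<close>; one vertex is left over.\<close>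

lemma parent_maps_unique_root:
  assumes "degree_sequence d" and p: "p \<in> parent_maps d s"
  shows "\<exists>!r. r \<in> {1..length d} \<and> p r = 0"
proof -
  define n where "n = length d"
  have pv: "p \<in> vertex_maps n" using p by (simp add: parent_maps_def n_def)
  have "p v \<le> n" for v using pv by (simp add: vertex_maps_def)
  then have a: "p v \<in> {1..n}" if "p v \<noteq> 0" for v using that by (simp add: Suc_le_eq)
  have b: "v \<in> {1..n}" if "v \<in> p -` {i}" "i \<in> {1..n}" for v i
    using vertex_maps_vimage[OF pv, of i] that by auto
  have "{v \<in> {1..n}. p v \<noteq> 0} = (\<Union>i\<in>{1..n}. p -` {i})"
  proof (intro set_eqI iffI)
    fix v assume "v \<in> {v \<in> {1..n}. p v \<noteq> 0}"
    then have "p v \<in> {1..n}" using a by simp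
    then show "v \<in> (\<Union>i\<in>{1..n}. p -` {i})" by (intro UN_I[of "p v"]) simp_all
  next
    fix v assume "v \<in> (\<Union>i\<in>{1..n}. p -` {i})"
    then obtain i where i: "i \<in> {1..n}" "v \<in> p -` {i}" by blast
    then have "p v \<noteq> 0" by auto
    then show "v \<in> {v \<in> {1..n}. p v \<noteq> 0}" using b[OF i(2,1)] by simp
  qed
  also have "card \<dots> = (\<Sum>i\<in>{1..n}. card (p -` {i}))"
    by (rule card_UN_disjoint) (auto intro: finite_vertex_maps_vimage[OF pv])
  also have "\<dots> = (\<Sum>i\<in>{1..n}. d ! (i - 1))"
    using p by (simp add: parent_maps_def n_def)
  also have "\<dots> = sum_list d"
    by (simp add: sum.atLeast1_atMost_eq sum_list_sum_nth n_def atLeast0LessThan)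
  finally have "card {v \<in> {1..n}. p v \<noteq> 0} + 1 = n"
    using assms(1) by (simp add: degree_sequence_def n_def)
  moreover have "card {1..n} = card {v \<in> {1..n}. p v \<noteq> 0} + card {v \<in> {1..n}. p v = 0}"
  proof -
    have "{1..n} = {v \<in> {1..n}. p v \<noteq> 0} \<union> {v \<in> {1..n}. p v = 0}" by auto
    then have "card {1..n} = card ({v \<in> {1..n}. p v \<noteq> 0} \<union> {v \<in> {1..n}. p v = 0})"
      by (rule arg_cong[where f = card])
    also have "\<dots> = card {v \<in> {1..n}. p v \<noteq> 0} + card {v \<in> {1..n}. p v = 0}"
      by (rule card_Un_disjoint) auto
    finally show ?thesis .
  qed
  ultimately have "card {v \<in> {1..n}. p v = 0} = 1" by simp
  then obtain r where "{v \<in> {1..n}. p v = 0} = {r}" by (rule card_1_singletonE)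
  then show ?thesis unfolding n_def by (intro ex1I[of _ r]) auto
qed

context
  fixes d s p n
  assumes deg: "degree_sequence d" and p: "p \<in> parent_maps d s"
  defines "n \<equiv> length d"
begin

lemma parent_maps_vanishes: "vanishes_by p s" and parent_maps_le: "p v \<le> n" and parent_maps_outside: "v \<notin> {1..n} \<Longrightarrow> p v = 0"
  using p by (auto simp: parent_maps_def vertex_maps_def n_def)

lemma tree_of_root: "snd (tree_of n p) \<in> {1..n}" "p (snd (tree_of n p)) = 0"
  using theI'[OF parent_maps_unique_root[OF deg p]] by (auto simp: tree_of_def n_def)

lemma tree_of_root_unique: "v \<in> {1..n} \<Longrightarrow> p v = 0 \<Longrightarrow> v = snd (tree_of n p)"
  using parent_maps_unique_root[OF deg p] tree_of_root by (auto simp: n_def)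

lemma pverts_tree_of: "pverts (fst (tree_of n p)) = {1..n}"
  and parcs_tree_of: "parcs (fst (tree_of n p)) = parent_arcs p"
  by (simp_all add: tree_of_def)

lemma parent_arcs_subset: "parent_arcs p \<subseteq> {1..n} \<times> {1..n}"
proof -
  have in_V: "v \<in> {1..n} \<and> p v \<in> {1..n}" if "p v \<noteq> 0" for v
    using parent_maps_le[of v] parent_maps_outside[of v] that by (cases "v \<in> {1..n}") auto
  show ?thesis
  proof (rule subrelI)
    fix v w assume "(v, w) \<in> parent_arcs p"
    then show "(v, w) \<in> {1..n} \<times> {1..n}"
      using in_V[of v] in_V[of w] by (auto simp: parent_arcs_def)
  qed
qed

lemma parent_arcs_depth:
  "(v, w) \<in> parent_arcs p \<Longrightarrow>
    p v = w \<and> depth p v = Suc (depth p w) \<or> p w = v \<and> depth p w = Suc (depth p v)"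
  using depth_Suc[OF parent_maps_vanishes] by (auto simp: parent_arcs_def)

lemma pair_graph_tree_of: "pair_graph (fst (tree_of n p))"
proof (rule pair_graphI)
  show "sym (parcs (fst (tree_of n p)))"
    unfolding parcs_tree_of by (auto intro: symI parent_arcs_sym)
  show "(v, v) \<notin> parcs (fst (tree_of n p))" for v
    unfolding parcs_tree_of using parent_arcs_depth[of v v] by auto
qed (use parent_arcs_subset in \<open>simp_all add: pverts_tree_of parcs_tree_of\<close>)

lemma depth_root: "depth p (snd (tree_of n p)) = 1"
  using depth_Suc[OF parent_maps_vanishes, of "snd (tree_of n p)"] tree_of_root by simp

lemma awalk_from_root:
  assumes "v \<in> {1..n}"
  shows "\<exists>q. pre_digraph.awalk (with_proj (fst (tree_of n p))) (snd (tree_of n p)) q v \<and>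
    length q + 1 = depth p v"
  using assms
proof (induction "depth p v" arbitrary: v rule: less_induct)
  case less
  show ?case
  proof (cases "p v = 0")
    case True
    then have "v = snd (tree_of n p)" using tree_of_root_unique less.prems by blast
    then show ?thesis using tree_of_root(1) depth_root
      by (intro exI[of _ "[]"]) (simp add: awalk_with_proj pverts_tree_of)
  next
    case False
    have v0: "v \<noteq> 0" using less.prems by simp
    have d: "depth p v = Suc (depth p (p v))" by (rule depth_Suc[OF parent_maps_vanishes v0])
    have "p v \<in> {1..n}" using False parent_maps_le[of v] by simp
    then obtain q where q: "pre_digraph.awalk (with_proj (fst (tree_of n p))) (snd (tree_of n p)) q (p v)"
      "length q + 1 = depth p (p v)"
      using less.hyps[of "p v"] d by auto
    have "(p v, v) \<in> parent_arcs p" using False v0 by (simp add: parent_arcs_def)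
    then show ?thesis using q d
      by (intro exI[of _ "q @ [(p v, v)]"]) (auto simp: awalk_with_proj parcs_tree_of pcas_append)
  qed
qed

lemma awalk_length_ge:
  assumes "pre_digraph.awalk (with_proj (fst (tree_of n p))) u q v"
  shows "depth p v \<le> depth p u + length q"
proof -
  have "set q \<subseteq> parent_arcs p" "pcas u q v" using assms by (auto simp: awalk_with_proj parcs_tree_of)
  then show ?thesis
  proof (induction q arbitrary: u)
    case (Cons e q)
    then have "(u, snd e) \<in> parent_arcs p" by (cases e) auto
    then have "depth p (snd e) \<le> depth p u + 1" using parent_arcs_depth by fastforce
    then show ?case using Cons by force
  qed simp
qed

text \<open>The path of ancestors bounds the distance from above; from below it is bounded because
  depth changes by only one along an arc. The shift by one is the step from the root to the
  sink.\<close>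

lemma graph_dist_tree_of:
  assumes "v \<in> {1..n}"
  shows "graph_dist (fst (tree_of n p)) (snd (tree_of n p)) v + 1 = depth p v"
proof -
  obtain q where q: "pre_digraph.awalk (with_proj (fst (tree_of n p))) (snd (tree_of n p)) q v"
    "length q + 1 = depth p v" using awalk_from_root[OF assms] by blast
  obtain q' where q': "pre_digraph.awalk (with_proj (fst (tree_of n p))) (snd (tree_of n p)) q' v"
    "length q' = graph_dist (fst (tree_of n p)) (snd (tree_of n p)) v"
    using graph_dist_witness[OF q(1)] by blast
  show ?thesis using graph_dist_le[OF q(1)] q(2) awalk_length_ge[OF q'(1)] q'(2) depth_root by simp
qed

lemma connected_tree_of: "Digraph_Component.connected (with_proj (fst (tree_of n p)))"
  unfolding connected_iff_awalk[OF pair_graph_tree_of] pverts_tree_of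
proof (intro conjI ballI)
  show "{1..n} \<noteq> {}" using tree_of_root by blast
  fix u v assume uv: "u \<in> {1..n}" "v \<in> {1..n}"
  interpret pair_graph "fst (tree_of n p)" by (rule pair_graph_tree_of)
  obtain q q' where q: "awalk (snd (tree_of n p)) q u" "awalk (snd (tree_of n p)) q' v"
    using awalk_from_root uv by blast
  then have "awalk u (rev_path q @ q') v" by (intro awalk_appendI[of _ _ "snd (tree_of n p)"]) simp_all
  then show "\<exists>q. awalk u q v" by blast
qed

text \<open>A deepest vertex of a cycle would have its parent as both of its neighbours on the cycle.\<close>

lemma no_cycle_tree_of:
  assumes cyc: "pre_digraph.cycle (with_proj (fst (tree_of n p))) c" and len: "length c \<ge> 3"
  shows False
proof -
  obtain u where arcs: "set c \<subseteq> parent_arcs p" and cas: "pcas u c u" and dist: "distinct (map snd c)"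
    and "c \<noteq> []"
    using cyc by (auto simp: cycle_with_proj awalk_with_proj parcs_tree_of tl_pawalk_verts)
  obtain e where e: "e \<in> set c" and e_max: "\<And>e'. e' \<in> set c \<Longrightarrow> depth p (snd e') \<le> depth p (snd e)"
  proof -
    define D where "D = (\<lambda>e. depth p (snd e)) ` set c"
    have D: "finite D" "D \<noteq> {}" using \<open>c \<noteq> []\<close> by (auto simp: D_def)
    have "Max D \<in> (\<lambda>e. depth p (snd e)) ` set c" using Max_in[OF D] by (simp only: D_def)
    then obtain e where e: "e \<in> set c" "Max D = depth p (snd e)" by blast
    show ?thesis
    proof (rule that[OF e(1)])
      fix e' assume "e' \<in> set c"
      then have "depth p (snd e') \<in> D" by (simp add: D_def)
      from Max_ge[OF D(1) this] show "depth p (snd e') \<le> depth p (snd e)" by (simp only: e(2))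
    qed
  qed
  obtain c1 c2 where c: "c = c1 @ e # c2" using e by (meson split_list)
  obtain x y where xy: "e = (x, y)" by (cases e)
  have "pcas u c1 x" "pcas y c2 u" using cas by (auto simp: c xy pcas_append)
  then have cas': "pcas y (c2 @ c1) x" by (auto simp: pcas_append)
  \<comment> \<open>Once the cycle is rotated to leave the deepest vertex \<open>y\<close>, at least
    two arcs remain besides \<open>e\<close>. Hence \<open>z\<close> and \<open>x\<close> are heads
    of different arcs and cannot coincide.\<close>
  have "length (c2 @ c1) \<ge> 2" using len c by simp
  then obtain f c' where f: "c2 @ c1 = f # c'" "c' \<noteq> []"
    by (cases "c2 @ c1") fastforce+
  then obtain z where z: "f = (y, z)" using cas' by (cases f) auto
  have x: "x = snd (last c')" using pcas_last[OF cas'] f by simp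
  have "distinct (map snd (c2 @ c1))" using dist by (auto simp: c)
  then have "z \<noteq> x" using f z x by (metis distinct.simps(2) last_in_set list.simps(9) image_eqI set_map snd_conv)
  have set_f: "set (f # c') \<subseteq> set c" unfolding f(1)[symmetric] by (auto simp: c)
  have "(x, y) \<in> parent_arcs p" "(y, z) \<in> parent_arcs p" using arcs e xy set_f z by auto
  moreover have "depth p x \<le> depth p y" "depth p z \<le> depth p y"
    using e_max[of "last c'"] e_max[of f] set_f last_in_set[OF f(2)] z xy x by auto
  ultimately have "p y = x" "p y = z" using parent_arcs_depth by fastforce+
  then show False using \<open>z \<noteq> x\<close> by simp
qed

lemma children_tree_of:
  assumes "v \<in> {1..n}"
  shows "children (tree_of n p) v = p -` {v}"
proof (intro set_eqI iffI)
  fix w assume "w \<in> children (tree_of n p) v"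
  then have w: "(v, w) \<in> parent_arcs p"
    "graph_dist (fst (tree_of n p)) (snd (tree_of n p)) w = graph_dist (fst (tree_of n p)) (snd (tree_of n p)) v + 1"
    by (auto simp: children_def parcs_tree_of)
  then have "w \<in> {1..n}" using parent_arcs_subset by blast
  then have "depth p w = Suc (depth p v)" using w(2) graph_dist_tree_of assms by (metis Suc_eq_plus1)
  then show "w \<in> p -` {v}" using parent_arcs_depth[OF w(1)] by auto
next
  fix w assume "w \<in> p -` {v}"
  then have pw: "p w = v" by simp
  have "w \<noteq> 0"
    by (rule notI) (use pw assms vanishes_by_fixes_0[OF parent_maps_vanishes] in simp)
  then have w: "(v, w) \<in> parent_arcs p" using pw assms by (simp add: parent_arcs_def)
  then have "w \<in> {1..n}" using parent_arcs_subset by blast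
  then have "graph_dist (fst (tree_of n p)) (snd (tree_of n p)) w = graph_dist (fst (tree_of n p)) (snd (tree_of n p)) v + 1"
    using graph_dist_tree_of[of w] graph_dist_tree_of[OF assms] depth_Suc[OF parent_maps_vanishes \<open>w \<noteq> 0\<close>] pw by simp
  then show "w \<in> children (tree_of n p) v" using w by (simp add: children_def parcs_tree_of)
qed

lemma tree_of_in_trees: "tree_of n p \<in> trees_with_degrees d"
proof -
  have "rooted_tree (tree_of n p)"
    unfolding rooted_tree_def is_tree_def
    using pair_graph_tree_of connected_tree_of no_cycle_tree_of tree_of_root(1) by (auto simp: pverts_tree_of)
  moreover have "card (children (tree_of n p) i) = d ! (i - 1)" if "i \<in> {1..n}" for i
    using children_tree_of[OF that] p that by (simp add: parent_maps_def n_def)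
  ultimately show ?thesis by (simp add: trees_with_degrees_def pverts_tree_of n_def[symmetric])
qed

lemma tree_height_tree_of: "tree_height (tree_of n p) \<le> t \<longleftrightarrow> vanishes_by p (Suc t)"
proof -
  have "tree_height (tree_of n p) \<le> t \<longleftrightarrow>
      (\<forall>v\<in>{1..n}. graph_dist (fst (tree_of n p)) (snd (tree_of n p)) v \<le> t)"
    unfolding tree_height_def pverts_tree_of using tree_of_root(1) by (subst Max_le_iff) auto
  also have "\<dots> \<longleftrightarrow> (\<forall>v\<in>{1..n}. depth p v \<le> Suc t)"
    using graph_dist_tree_of by (metis Suc_eq_plus1 Suc_le_mono)
  also have "\<dots> \<longleftrightarrow> (\<forall>v. depth p v \<le> Suc t)"
  proof -
    \<comment> \<open>Off the vertices one step reaches the sink, and \<open>Suc t\<close> is at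
      least \<open>1\<close>.\<close>
    have "depth p v \<le> Suc t" if "v \<notin> {1..n}" for v
    proof -
      have "depth p v \<le> 1" unfolding depth_le_iff[OF parent_maps_vanishes] using parent_maps_outside[OF that] by simp
      then show ?thesis by simp
    qed
    then show ?thesis by blast
  qed
  also have "\<dots> \<longleftrightarrow> vanishes_by p (Suc t)"
    unfolding vanishes_by_def depth_le_iff[OF parent_maps_vanishes] ..
  finally show ?thesis .
qed

end

section \<open>Recovering the parent map from the tree\<close>

text \<open>Depths are distances from the root plus one, so the tree determines them; the parent of
  a vertex is its neighbour of smaller depth.\<close>

lemma tree_of_inj:
  assumes deg: "degree_sequence d" and p: "p \<in> parent_maps d s" and q: "q \<in> parent_maps d t"
    and eq: "tree_of (length d) p = tree_of (length d) q"
  shows "p = q"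
proof
  fix v
  define n where "n = length d"
  have depth_eq: "depth p w = depth q w" if "w \<in> {1..n}" for w
    using graph_dist_tree_of[OF deg p, of w] graph_dist_tree_of[OF deg q, of w] that eq
    by (simp add: n_def)
  have arcs: "parent_arcs p = parent_arcs q"
    using eq by (simp add: tree_of_def)
  note van_p = parent_maps_vanishes[OF deg p] and van_q = parent_maps_vanishes[OF deg q]
  show "p v = q v"
  proof (cases "v \<in> {1..n} \<and> p v \<noteq> 0")
    case True
    then have "(v, p v) \<in> parent_arcs p" by (auto simp: parent_arcs_def)
    then have arc: "(v, p v) \<in> parent_arcs q" using arcs by simp
    have "p v \<in> {1..n}" using True parent_maps_le[OF deg p, of v] by (simp add: n_def Suc_le_eq)
    then have "depth q v = Suc (depth q (p v))"
      using depth_Suc[OF van_p, of v] depth_eq[of v] depth_eq[of "p v"] True by simp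
    then show ?thesis using parent_arcs_depth[OF deg q arc] by auto
  next
    case False
    show ?thesis
    proof (cases "v \<in> {1..n}")
      case True
      then have "v = snd (tree_of n q)"
        using False tree_of_root_unique[OF deg p, of v] eq by (simp add: n_def)
      then have "q v = 0" using tree_of_root(2)[OF deg q] by (simp add: n_def)
      then show ?thesis using False True by simp
    next
      case out: False
      then have "p v = 0" "q v = 0"
        using parent_maps_outside[OF deg p, of v] parent_maps_outside[OF deg q, of v] by (simp_all add: n_def)
      then show ?thesis by simp
    qed
  qed
qed

text \<open>A path inside \<open>A\<close> closed up by an arc outside \<open>A\<close> is a cycle.
  It has length at least \<open>3\<close>, since a path of one arc would be the reverse arc, which
  symmetry keeps out of \<open>A\<close>.\<close>

lemma no_cycle_imp_arc_in:
  assumes graph: "pair_graph G"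
    and acyclic: "\<And>c. pre_digraph.cycle (with_proj G) c \<Longrightarrow> length c < 3"
    and A: "A \<subseteq> parcs G" "sym A"
    and q: "pre_digraph.awalk (with_proj G) v q u" "set q \<subseteq> A"
    and uv: "(u, v) \<in> parcs G"
  shows "(u, v) \<in> A"
proof (rule ccontr)
  interpret pair_graph G by (rule graph)
  assume notin: "(u, v) \<notin> A"
  then have notin': "(v, u) \<notin> A" using A(2) by (auto dest: symD)
  define c where "c = awalk_to_apath q"
  have c: "apath v c u" "set c \<subseteq> A"
    using apath_awalk_to_apath[OF q(1)] awalk_to_apath_subset[OF q(1)] q(2) by (auto simp: c_def)
  have "u \<noteq> v" using uv no_loops' by blast
  then have "c \<noteq> []" using c(1) by (auto simp: apath_def awalk_def)
  have "cycle ((u, v) # c)"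
    unfolding cycle_def
    using c(1) uv by (intro exI[of _ u]) (auto simp: apath_def awalk_Cons_iff)
  then have "length c < 2" using acyclic by fastforce
  then obtain e where "c = [e]" using \<open>c \<noteq> []\<close> by (cases c) auto
  then have "(v, u) \<in> A" using c by (cases e) (auto simp: apath_def awalk_def)
  then show False using notin' by simp
qed

text \<open>As parent serves a neighbour one step closer to the root. The parent arcs connect every
  vertex to the root, so by acyclicity they exhaust the arcs of the tree.\<close>

lemma tree_of_surj:
  assumes deg: "degree_sequence d" and T: "T \<in> trees_with_degrees d"
  shows "\<exists>p s. p \<in> parent_maps d s \<and> tree_of (length d) p = T"
proof -
  define n where "n = length d"
  define G where "G = fst T"
  define r where "r = snd T"
  have verts: "pverts G = {1..n}" and r: "r \<in> {1..n}"
    and ch: "\<And>i. i \<in> {1..n} \<Longrightarrow> card (children T i) = d ! (i - 1)"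
    and tree: "is_tree G"
    using T by (auto simp: trees_with_degrees_def rooted_tree_def G_def r_def n_def)
  interpret pair_graph G using tree by (simp add: is_tree_def)
  have acyclic: "length c < 3" if "cycle c" for c
    using tree that by (auto simp: is_tree_def not_less[symmetric])
  define dst where "dst v = graph_dist G r v" for v
  have walk: "\<exists>q. awalk r q v \<and> length q = dst v" if "v \<in> {1..n}" for v
  proof -
    have conn: "\<forall>u\<in>pverts G. \<forall>v\<in>pverts G. \<exists>p. awalk u p v"
      using tree unfolding is_tree_def connected_iff_awalk[OF pair_graph] by blast
    have "r \<in> pverts G" "v \<in> pverts G" using r that verts by simp_all
    then obtain q where "awalk r q v" using conn by meson
    then show ?thesis unfolding dst_def using graph_dist_witness by metis
  qed
  have dst_le: "dst v \<le> length q" if "awalk r q v" for q v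
    unfolding dst_def by (rule graph_dist_le[OF that])
  have ex_parent: "\<exists>u. (u, v) \<in> parcs G \<and> Suc (dst u) = dst v" if v: "v \<in> {1..n}" "v \<noteq> r" for v
  proof -
    \<comment> \<open>The candidate is the last but one vertex of a shortest walk from the
      root.\<close>
    obtain q where q: "awalk r q v" "length q = dst v" using walk v by blast
    then have "q \<noteq> []" using v by (auto simp: awalk_def)
    then obtain q' e where "q = q' @ [e]" by (metis append_butlast_last_id)
    moreover obtain u w where "e = (u, w)" by (cases e)
    ultimately have q': "q = q' @ [(u, v)]" using q(1) by (auto simp: awalk_def pcas_append)
    then have u: "awalk r q' u" "(u, v) \<in> parcs G" using q(1) by (auto simp: awalk_def pcas_append)
    have le: "dst u \<le> length q'" by (rule dst_le[OF u(1)])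
    obtain q'' where q'': "awalk r q'' u" "length q'' = dst u"
      using walk[of u] u(2) verts in_arcsD1 by blast
    then have "awalk r (q'' @ [(u, v)]) v" using u(2) by (auto simp: awalk_def pcas_append)
    then have "dst v \<le> length (q'' @ [(u, v)])" by (rule dst_le)
    then have "dst v \<le> Suc (dst u)" using q''(2) by simp
    then have "Suc (dst u) = dst v" using le q(2) q' by simp
    then show ?thesis using u(2) by blast
  qed
  define p where "p v = (if v \<in> {1..n} \<and> v \<noteq> r then SOME u. (u, v) \<in> parcs G \<and> Suc (dst u) = dst v else 0)" for v
  have parent: "(p v, v) \<in> parcs G" "Suc (dst (p v)) = dst v" "p v \<in> {1..n}" if "v \<in> {1..n}" "v \<noteq> r" for v
  proof -
    show *: "(p v, v) \<in> parcs G" "Suc (dst (p v)) = dst v"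
      using someI_ex[OF ex_parent[OF that]] that by (simp_all add: p_def)
    show "p v \<in> {1..n}" using in_arcsD1[OF *(1)] verts by simp
  qed
  have p0: "p v = 0" if "v \<notin> {1..n} \<or> v = r" for v using that by (auto simp: p_def)
  have p_nz: "v \<in> {1..n} \<and> v \<noteq> r" if "p v \<noteq> 0" for v using p0[of v] that by blast
  have sub: "parent_arcs p \<subseteq> parcs G"
  proof (rule subrelI)
    fix v w assume "(v, w) \<in> parent_arcs p"
    then consider "p v = w" "w \<noteq> 0" | "p w = v" "v \<noteq> 0" by (auto simp: parent_arcs_def)
    then show "(v, w) \<in> parcs G"
    proof cases
      case 1
      then show ?thesis using parent(1)[of v] p_nz[of v] arcs_symmetric by blast
    next
      case 2
      then show ?thesis using parent(1)[of w] p_nz[of w] by blast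
    qed
  qed
  have sym: "sym (parent_arcs p)" by (auto intro: symI parent_arcs_sym)
  have to_root: "\<exists>q. awalk v q r \<and> set q \<subseteq> parent_arcs p" if "v \<in> {1..n}" for v
    using that
  proof (induction "dst v" arbitrary: v rule: less_induct)
    case less
    show ?case
    proof (cases "v = r")
      case True
      then show ?thesis using less.prems verts by (intro exI[of _ "[]"]) (simp add: awalk_def)
    next
      case False
      note par = parent[OF less.prems False]
      then obtain q where q: "awalk (p v) q r" "set q \<subseteq> parent_arcs p"
        using less.hyps[of "p v"] by auto
      have "(v, p v) \<in> parent_arcs p" using par(3) less.prems by (auto simp: parent_arcs_def)
      then show ?thesis using q sub par(1) less.prems verts
        by (intro exI[of _ "(v, p v) # q"]) (auto simp: awalk_def)
    qed
  qed
  have arcs: "parcs G = parent_arcs p"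
  proof
    show "parcs G \<subseteq> parent_arcs p"
    proof (rule subrelI)
      fix u v assume uv: "(u, v) \<in> parcs G"
      then have "u \<in> {1..n}" "v \<in> {1..n}" using in_arcsD1 in_arcsD2 verts by auto
      then obtain q q' where q: "awalk v q r" "set q \<subseteq> parent_arcs p" "awalk u q' r" "set q' \<subseteq> parent_arcs p"
        using to_root by meson
      have "set (rev_path q') \<subseteq> parent_arcs p"
        using q(4) parent_arcs_sym by (induction q') auto
      moreover have "awalk v (q @ rev_path q') u"
        by (rule awalk_appendI[OF q(1)]) (simp add: q(3))
      moreover from calculation have "set (q @ rev_path q') \<subseteq> parent_arcs p"
        using q(2) by simp
      ultimately show "(u, v) \<in> parent_arcs p"
        by (intro no_cycle_imp_arc_in[OF pair_graph acyclic sub sym _ _ uv])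
    qed
  qed (rule sub)
  have p_le: "p v \<le> n" for v using parent(3)[of v] p_nz[of v] by (cases "p v = 0") auto
  have "p \<in> vertex_maps n" using p0 p_le by (auto simp: vertex_maps_def)
  moreover have "card (p -` {i}) = d ! (i - 1)" if i: "i \<in> {1..n}" for i
  proof -
    have "children T i = p -` {i}"
    proof (intro set_eqI iffI)
      fix w assume "w \<in> children T i"
      then have w: "(i, w) \<in> parent_arcs p" "dst w = Suc (dst i)"
        by (auto simp: children_def G_def[symmetric] r_def[symmetric] dst_def arcs)
      have "p i \<noteq> w"
      proof
        assume "p i = w"
        moreover from this have "p i \<noteq> 0" using w(1) by (auto simp: parent_arcs_def)
        ultimately show False using parent(2)[of i] p_nz[of i] w(2) by auto
      qed
      then show "w \<in> p -` {i}" using w(1) by (auto simp: parent_arcs_def)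
    next
      fix w assume "w \<in> p -` {i}"
      then have pw: "p w = i" by simp
      then have "p w \<noteq> 0" using i by simp
      from p_nz[OF this] have "(i, w) \<in> parcs G" "Suc (dst i) = dst w" using parent[of w] pw by auto
      then show "w \<in> children T i"
        by (simp add: children_def G_def[symmetric] r_def[symmetric] dst_def)
    qed
    then show ?thesis using ch[OF i] by simp
  qed
  \<comment> \<open>The value \<open>1\<close> off the vertices only has to exceed the value
    \<open>0\<close> at the sink. The sum of all distances is a convenient bound for each of
    them.\<close>
  moreover have "vanishes_by p (Suc (\<Sum>v\<in>{1..n}. dst v))"
  proof (rule vanishes_by_rank[where rk = "\<lambda>v. if v \<in> {1..n} then Suc (dst v) else if v = 0 then 0 else 1"])
    show "p 0 = 0" by (rule p0) simp
  next
    fix v :: nat assume v: "v \<noteq> 0"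
    show "(if p v \<in> {1..n} then Suc (dst (p v)) else if p v = 0 then 0 else 1)
      < (if v \<in> {1..n} then Suc (dst v) else if v = 0 then 0 else 1)"
    proof (cases "v \<in> {1..n} \<and> v \<noteq> r")
      case True
      then show ?thesis using parent(2,3)[of v] by auto
    next
      case False
      have "p v = 0" by (rule p0) (use False in blast)
      then show ?thesis using v by simp
    qed
  next
    fix v
    have "dst v \<le> (\<Sum>v\<in>{1..n}. dst v)" if "v \<in> {1..n}" using that by (rule member_le_sum) simp_all
    then show "(if v \<in> {1..n} then Suc (dst v) else if v = 0 then 0 else 1) \<le> Suc (\<Sum>v\<in>{1..n}. dst v)"
      by auto
  qed
  ultimately have pm: "p \<in> parent_maps d (Suc (\<Sum>v\<in>{1..n}. dst v))"
    by (simp add: parent_maps_def n_def)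
  have "(THE r. r \<in> {1..n} \<and> p r = 0) = r"
    using parent_maps_unique_root[OF deg pm] r p0[of r] by (intro the1_equality) (auto simp: n_def)
  then have "tree_of n p = (\<lparr>pverts = {1..n}, parcs = parent_arcs p\<rparr>, r)"
    by (simp add: tree_of_def)
  also have "\<dots> = (G, r)" using verts arcs by simp
  also have "\<dots> = T" by (simp add: G_def r_def)
  finally show ?thesis using pm by (auto simp: n_def)
qed

text \<open>The bound is \<open>Suc t\<close> because depth is counted from the sink, one step above
  the root.\<close>

lemma bij_betw_tree_of:
  assumes "degree_sequence d"
  shows "bij_betw (tree_of (length d)) (parent_maps d (Suc t)) {T \<in> trees_with_degrees d. tree_height T \<le> t}"
proof (rule bij_betw_imageI)
  show "inj_on (tree_of (length d)) (parent_maps d (Suc t))"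
    by (rule inj_onI) (rule tree_of_inj[OF assms])
  show "tree_of (length d) ` parent_maps d (Suc t) = {T \<in> trees_with_degrees d. tree_height T \<le> t}"
  proof (intro set_eqI iffI)
    fix T assume "T \<in> tree_of (length d) ` parent_maps d (Suc t)"
    then obtain p where p: "T = tree_of (length d) p" "p \<in> parent_maps d (Suc t)" by blast
    then show "T \<in> {T \<in> trees_with_degrees d. tree_height T \<le> t}"
      using tree_of_in_trees[OF assms p(2)] tree_height_tree_of[OF assms p(2), of t]
      by (simp add: parent_maps_def)
  next
    fix T assume T: "T \<in> {T \<in> trees_with_degrees d. tree_height T \<le> t}"
    then obtain p s where p: "p \<in> parent_maps d s" "tree_of (length d) p = T"
      using tree_of_surj[OF assms] by blast
    then have "p \<in> parent_maps d (Suc t)"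
      using T tree_height_tree_of[OF assms p(1), of t] by (simp add: parent_maps_def)
    then show "T \<in> tree_of (length d) ` parent_maps d (Suc t)" using p(2) by blast
  qed
qed

lemma card_trees_height_le:
  "degree_sequence d \<Longrightarrow>
    card {T \<in> trees_with_degrees d. tree_height T \<le> t} = card (parent_maps d (Suc t))"
  by (rule bij_betw_same_card[OF bij_betw_tree_of, symmetric])

text \<open>For large bounds the height restriction is void, so the parent maps stabilise at an
  encoding of all trees; finiteness follows as well.\<close>

lemma trees_height_eventually:
  assumes "degree_sequence d"
  obtains N where "finite (trees_with_degrees d)"
    "\<And>s. N \<le> s \<Longrightarrow> card (trees_with_degrees d) = card (parent_maps d s)"
proof -
  obtain N where N: "\<And>s. N \<le> s \<Longrightarrow> parent_maps d s = parent_maps d N"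
    using card_parent_maps_eventually[of d] by blast
  have "trees_with_degrees d = tree_of (length d) ` parent_maps d N"
  proof (intro set_eqI iffI)
    fix T assume T: "T \<in> trees_with_degrees d"
    then obtain p s where p: "p \<in> parent_maps d s" "tree_of (length d) p = T"
      using tree_of_surj[OF assms] by blast
    have "p \<in> parent_maps d (max s N)"
      using p(1) vanishes_by_mono[of p s "max s N"] by (simp add: parent_maps_def)
    then show "T \<in> tree_of (length d) ` parent_maps d N" using N[of "max s N"] p(2) by auto
  qed (use tree_of_in_trees[OF assms] in auto)
  moreover have "inj_on (tree_of (length d)) (parent_maps d N)"
    by (rule inj_onI) (rule tree_of_inj[OF assms])
  ultimately have fin: "finite (trees_with_degrees d)"
    and card: "card (trees_with_degrees d) = card (parent_maps d N)"
    by (simp_all add: card_image)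
  show ?thesis
  proof (rule that[of N])
    show "finite (trees_with_degrees d)" by (rule fin)
  next
    fix s assume "N \<le> s"
    show "card (trees_with_degrees d) = card (parent_maps d s)"
      unfolding N[OF \<open>N \<le> s\<close>] by (rule card)
  qed
qed

section \<open>Stochastic order of the heights\<close>

lemma uniform_random_element_card_pos:
  assumes "uniform_random_element P X A" "finite A"
  shows "card A > 0"
proof -
  interpret prob_space P using assms(1) by (simp add: uniform_random_element_def)
  obtain \<omega> where \<omega>: "\<omega> \<in> space P" using not_empty by blast
  have "X \<in> measurable P (count_space A)" using assms(1) by (simp add: uniform_random_element_def)
  from measurable_space[OF this \<omega>] have "A \<noteq> {}" by auto
  then show ?thesis using assms(2) by (simp add: card_gt_0_iff)
qed

lemma measure_uniform_random_element:
  assumes "uniform_random_element P X A" "finite A"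
  shows "measure P {\<omega> \<in> space P. Q (X \<omega>)} = card {a \<in> A. Q a} / card A"
proof -
  have X: "X \<in> measurable P (count_space A)" and distr: "distr P (count_space A) X = uniform_count_measure A"
    using assms(1) by (simp_all add: uniform_random_element_def)
  have "{\<omega> \<in> space P. Q (X \<omega>)} = X -` {a \<in> A. Q a} \<inter> space P"
    using measurable_space[OF X] by auto
  then have "measure P {\<omega> \<in> space P. Q (X \<omega>)} = measure (distr P (count_space A) X) {a \<in> A. Q a}"
    using measure_distr[OF X, of "{a \<in> A. Q a}"] by simp
  also have "\<dots> = card {a \<in> A. Q a} / card A"
    unfolding distr by (rule measure_uniform_count_measure[OF assms(2)]) auto
  finally show ?thesis .
qed

text \<open>Both distribution functions are quotients of numbers of parent maps. Domination compares
  the numerators up to a factor that is exactly the quotient of the denominators.\<close>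

theorem corollary11:
  fixes b d :: "nat list"
    and P :: "'p measure" and T_d :: "'p \<Rightarrow> nat rooted_graph"
    and Q :: "'q measure" and T_b :: "'q \<Rightarrow> nat rooted_graph"
  assumes "degree_sequence b" and "sub_binary b"
    and "degree_sequence d"
    and "count_list d 0 = count_list b 0" and "count_list d 1 = count_list b 1"
    and "uniform_random_element P T_d (trees_with_degrees d)"
    and "uniform_random_element Q T_b (trees_with_degrees b)"
  shows "stochastically_le P (\<lambda>\<omega>. real (tree_height (T_d \<omega>))) Q (\<lambda>\<omega>. real (tree_height (T_b \<omega>)))"
  unfolding stochastically_le_def
proof
  fix t :: real
  obtain N where fin_d: "finite (trees_with_degrees d)"
    and N: "\<And>s. N \<le> s \<Longrightarrow> card (trees_with_degrees d) = card (parent_maps d s)"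
    using trees_height_eventually[OF assms(3)] by blast
  obtain N' where fin_b: "finite (trees_with_degrees b)"
    and N': "\<And>s. N' \<le> s \<Longrightarrow> card (trees_with_degrees b) = card (parent_maps b s)"
    using trees_height_eventually[OF assms(1)] by blast
  obtain x y M where xy: "x > 0" "y > 0"
     and le: "\<And>s. x * card (parent_maps b s) \<le> y * card (parent_maps d s)"
     and eq: "\<And>s. M \<le> s \<Longrightarrow> x * card (parent_maps b s) = y * card (parent_maps d s)"
    using dominated_sub_binary[OF assms(1-5)] unfolding dominated_def by blast
  define D where "D = card (trees_with_degrees d)"
  define B where "B = card (trees_with_degrees b)"
  have D: "D > 0" and B: "B > 0"
    using uniform_random_element_card_pos assms(6,7) fin_d fin_b by (auto simp: D_def B_def)
  \<comment> \<open>Beyond all three thresholds the counts are the total numbers of trees.\<close>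
  have BD: "x * B = y * D"
    using eq[of "M + N + N'"] N[of "M + N + N'"] N'[of "M + N + N'"] by (simp add: B_def D_def)
  show "measure Q {\<omega> \<in> space Q. real (tree_height (T_b \<omega>)) \<le> t}
      \<le> measure P {\<omega> \<in> space P. real (tree_height (T_d \<omega>)) \<le> t}"
  \<comment> \<open>The rounded threshold \<open>k\<close> is right only for
    \<open>t \<ge> 0\<close>. Heights are never negative, so for \<open>t < 0\<close> the event on
    the left is empty.\<close>
  proof (cases "t < 0")
    case True
    then have empty: "{\<omega> \<in> space Q. real (tree_height (T_b \<omega>)) \<le> t} = {}"
      by (auto simp: not_le intro: less_le_trans)
    show ?thesis unfolding empty by simp
  next
    case False
    define k where "k = nat \<lfloor>t\<rfloor>"
    define cb where "cb = card (parent_maps b (Suc k))"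
    define cd where "cd = card (parent_maps d (Suc k))"
    have floor: "real m \<le> t \<longleftrightarrow> m \<le> k" for m
      using False unfolding k_def by linarith
    \<comment> \<open>After multiplication by \<open>D\<close> the product \<open>y * D\<close> can
      be replaced by \<open>x * B\<close>, and \<open>x\<close> cancels.\<close>
    have "x * (cb * D) \<le> y * cd * D"
      using le[of "Suc k"] by (simp add: cb_def cd_def mult.assoc[symmetric])
    also have "\<dots> = x * (cd * B)" using BD by (simp add: mult_ac)
    finally have "cb * D \<le> cd * B" using xy(1) by simp
    then have "real cb * real D \<le> real cd * real B" by (metis of_nat_le_iff of_nat_mult)
    then have "real cb / real B \<le> real cd / real D"
      using B D by (simp add: divide_le_eq pos_le_divide_eq mult.commute)
    then show ?thesis
      using measure_uniform_random_element[OF assms(6) fin_d, of "\<lambda>T. tree_height T \<le> k"]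
        measure_uniform_random_element[OF assms(7) fin_b, of "\<lambda>T. tree_height T \<le> k"]
        card_trees_height_le[OF assms(3), of k] card_trees_height_le[OF assms(1), of k]
      by (simp add: floor cb_def cd_def B_def D_def)
  qed
qed

end
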